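(* There is an algorithm that, given an instance of SF+, outputs a feasible solution $F$ with $\ell(F)\le 2\cdot\mathrm{OPT}$ in time $f(K)\cdot p(\text{input size})$, where $K=\sum_{i=1}^k|S_i|$ is the total number of terminals, $f$ is a computable function and $p$ a polynomial; i.e., approximating SF+ within a factor of 2 is fixed-parameter tractable in the total number of terminals.
   Context: SF+: given a connected graph $G=(V,E)$ with edge lengths $\ell\colon E\to\mathbb{R}_{\ge0}$ and $k$ pairwise disjoint sets $S_1,\dots,S_k\subseteq V$, find a forest $F\subseteq E$ of minimum total length $\ell(F)=\sum_{e\in F}\ell(e)$ such that each $S_i$ is contained in a single connected component of $(V,F)$ and every vertex of $V\setminus\bigcup_i S_i$ lies in the same connected component of $(V,F)$ as some vertex of $\bigcup_i S_i$. $\mathrm{OPT}$ denotes the optimum value. *)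

theory Defs
  imports Complex_Main "HOL-Computational_Algebra.Polynomial"
begin

section \<open>The machine model\<close>

text \<open>
  Time is measured on deeply embedded first-order LISP programs: a program is a finite list of
  function bodies working on binary trees, and its running time is the number of expression nodes
  evaluated.  Leaves of a tree may hold a vertex name, which can only be tested for equality, or a
  real number, on which the only operations are the constant 0, addition and comparison.  There is
  no rounding, multiplication or other way to pack information into a number.  Edge lengths can
  therefore be arbitrary reals, of unit size.  When all lengths of the input are rational, every
  number arising within \<open>t\<close> steps is a combination of input lengths with natural coefficients
  of at most \<open>2 ^ t\<close>, so its bit length is at most linear in \<open>t\<close> plus the bit length of the
  input, and the model is polynomially equivalent to Turing machines.
\<close>

datatype val = Nul | Vert nat | Num real | Cell val val

datatype exp =
    Var nat
  | NulE
  | CellE exp exp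
  | Fst exp
  | Snd exp
  | Cond exp exp exp
  | SameVert exp exp
  | Zero
  | Plus exp exp
  | LessEq exp exp
  | Call nat "exp list"

text \<open>\<open>Call i\<close> calls the function whose body is at position \<open>i\<close>; position 0 is the main function.\<close>

type_synonym program = "exp list"

definition of_truth :: "bool \<Rightarrow> val" where
  "of_truth b = (if b then Cell Nul Nul else Nul)"

text \<open>Ill-typed applications of the primitives return \<open>Nul\<close>.\<close>

fun val_fst :: "val \<Rightarrow> val" where
  "val_fst (Cell a b) = a"
| "val_fst _ = Nul"

fun val_snd :: "val \<Rightarrow> val" where
  "val_snd (Cell a b) = b"
| "val_snd _ = Nul"

fun val_same_vert :: "val \<Rightarrow> val \<Rightarrow> val" where
  "val_same_vert (Vert u) (Vert v) = of_truth (u = v)"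
| "val_same_vert _ _ = Nul"

fun val_plus :: "val \<Rightarrow> val \<Rightarrow> val" where
  "val_plus (Num r) (Num s) = Num (r + s)"
| "val_plus _ _ = Nul"

fun val_less_eq :: "val \<Rightarrow> val \<Rightarrow> val" where
  "val_less_eq (Num r) (Num s) = of_truth (r \<le> s)"
| "val_less_eq _ _ = Nul"

text \<open>
  \<open>eval P env e v t\<close>: in program \<open>P\<close>, with argument list \<open>env\<close>, the expression \<open>e\<close> evaluates
  to \<open>v\<close> in exactly \<open>t\<close> steps.  Divergence is the absence of a derivation.
\<close>

inductive eval :: "program \<Rightarrow> val list \<Rightarrow> exp \<Rightarrow> val \<Rightarrow> nat \<Rightarrow> bool"
  and evals :: "program \<Rightarrow> val list \<Rightarrow> exp list \<Rightarrow> val list \<Rightarrow> nat \<Rightarrow> bool"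
  for P :: program
  where
  Var: "i < length env \<Longrightarrow> eval P env (Var i) (env ! i) 1"
| NulE: "eval P env NulE Nul 1"
| CellE: "eval P env a v s \<Longrightarrow> eval P env b w t
    \<Longrightarrow> eval P env (CellE a b) (Cell v w) (s + t + 1)"
| Fst: "eval P env a v t \<Longrightarrow> eval P env (Fst a) (val_fst v) (t + 1)"
| Snd: "eval P env a v t \<Longrightarrow> eval P env (Snd a) (val_snd v) (t + 1)"
| CondT: "eval P env c u s \<Longrightarrow> u \<noteq> Nul \<Longrightarrow> eval P env a v t
    \<Longrightarrow> eval P env (Cond c a b) v (s + t + 1)"
| CondF: "eval P env c Nul s \<Longrightarrow> eval P env b v t
    \<Longrightarrow> eval P env (Cond c a b) v (s + t + 1)"
| SameVert: "eval P env a v s \<Longrightarrow> eval P env b w t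
    \<Longrightarrow> eval P env (SameVert a b) (val_same_vert v w) (s + t + 1)"
| Zero: "eval P env Zero (Num 0) 1"
| Plus: "eval P env a v s \<Longrightarrow> eval P env b w t
    \<Longrightarrow> eval P env (Plus a b) (val_plus v w) (s + t + 1)"
| LessEq: "eval P env a v s \<Longrightarrow> eval P env b w t
    \<Longrightarrow> eval P env (LessEq a b) (val_less_eq v w) (s + t + 1)"
| Call: "evals P env as vs s \<Longrightarrow> i < length P \<Longrightarrow> eval P vs (P ! i) v t
    \<Longrightarrow> eval P env (Call i as) v (s + t + 1)"
| Nil: "evals P env [] [] 0"
| Cons: "eval P env a v s \<Longrightarrow> evals P env as vs t
    \<Longrightarrow> evals P env (a # as) (v # vs) (s + t)"

definition runs :: "program \<Rightarrow> val \<Rightarrow> val \<Rightarrow> nat \<Rightarrow> bool" where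
  "runs P x y t \<longleftrightarrow> eval P [x] (Call 0 [Var 0]) y t"

lemma eval_deterministic:
  "eval P env e v t \<Longrightarrow> eval P env e v' t' \<Longrightarrow> v' = v \<and> t' = t"
  "evals P env es vs t \<Longrightarrow> evals P env es vs' t' \<Longrightarrow> vs' = vs \<and> t' = t"
proof (induction arbitrary: v' t' and vs' t' rule: eval_evals.inducts)
  case Var
  from Var.prems show ?case by cases simp_all
next
  case NulE
  from NulE.prems show ?case by cases simp_all
next
  case CellE
  from CellE.prems show ?case by cases (use CellE.IH in blast)+
next
  case Fst
  from Fst.prems show ?case by cases (use Fst.IH in blast)+
next
  case Snd
  from Snd.prems show ?case by cases (use Snd.IH in blast)+
next
  case CondT
  from CondT.prems show ?case by cases (use CondT in blast)+
next
  case CondF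
  from CondF.prems show ?case by cases (use CondF in blast)+
next
  case SameVert
  from SameVert.prems show ?case by cases (use SameVert.IH in blast)+
next
  case Zero
  from Zero.prems show ?case by cases simp_all
next
  case Plus
  from Plus.prems show ?case by cases (use Plus.IH in blast)+
next
  case LessEq
  from LessEq.prems show ?case by cases (use LessEq.IH in blast)+
next
  case Call
  from Call.prems show ?case by cases (use Call.IH in blast)+
next
  case Nil
  from Nil.prems show ?case by cases simp_all
next
  case Cons
  from Cons.prems show ?case by cases (use Cons.IH in blast)+
qed

lemma runs_deterministic: "runs P x y t \<Longrightarrow> runs P x y' t' \<Longrightarrow> y' = y \<and> t' = t"
  unfolding runs_def by (rule eval_deterministic(1))

fun val_list :: "val list \<Rightarrow> val" where
  "val_list [] = Nul"
| "val_list (v # vs) = Cell v (val_list vs)"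

fun val_size :: "val \<Rightarrow> nat" where
  "val_size (Cell a b) = val_size a + val_size b + 1"
| "val_size _ = 1"

text \<open>
  Natural numbers are given to a program in unary.  The resulting notion of computability is that of
  Turing, since the tree operations alone already simulate Turing machines.
\<close>

definition unary :: "nat \<Rightarrow> val" where
  "unary n = val_list (replicate n Nul)"

definition computable :: "(nat \<Rightarrow> nat) \<Rightarrow> bool" where
  "computable f \<longleftrightarrow> (\<exists>P. \<forall>n. \<exists>t. runs P (unary n) (unary (f n)) t)"


section \<open>Graphs\<close>

definition linked :: "'a set set \<Rightarrow> 'a \<Rightarrow> 'a \<Rightarrow> bool" where
  "linked F u v \<longleftrightarrow> (u, v) \<in> {(a, b). {a, b} \<in> F}\<^sup>*"

definition is_cycle :: "'a set set \<Rightarrow> 'a list \<Rightarrow> bool" where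
  "is_cycle F c \<longleftrightarrow> 3 \<le> length c \<and> distinct c \<and>
     (\<forall>i < length c. {c ! i, c ! (Suc i mod length c)} \<in> F)"

definition forest :: "'a set set \<Rightarrow> bool" where
  "forest F \<longleftrightarrow> (\<nexists>c. is_cycle F c)"


section \<open>The problem SF+\<close>

record sf_instance =
  verts :: "nat set"
  edges :: "nat set set"
  len :: "nat set \<Rightarrow> real"
  terms :: "nat set list"

definition terminals :: "sf_instance \<Rightarrow> nat set" where
  "terminals I = \<Union> (set (terms I))"

definition sf_valid :: "sf_instance \<Rightarrow> bool" where
  "sf_valid I \<longleftrightarrow>
     finite (verts I) \<and>
     edges I \<subseteq> {e. e \<subseteq> verts I \<and> card e = 2} \<and>
     (\<forall>u \<in> verts I. \<forall>v \<in> verts I. linked (edges I) u v) \<and>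
     (\<forall>e \<in> edges I. 0 \<le> len I e) \<and>
     terminals I \<subseteq> verts I \<and>
     (\<forall>i j. i < j \<and> j < length (terms I) \<longrightarrow> terms I ! i \<inter> terms I ! j = {})"

definition feasible :: "sf_instance \<Rightarrow> nat set set \<Rightarrow> bool" where
  "feasible I F \<longleftrightarrow>
     F \<subseteq> edges I \<and> forest F \<and>
     (\<forall>S \<in> set (terms I). \<forall>u \<in> S. \<forall>v \<in> S. linked F u v) \<and>
     (\<forall>v \<in> verts I - terminals I. \<exists>u \<in> terminals I. linked F v u)"

definition total_len :: "sf_instance \<Rightarrow> nat set set \<Rightarrow> real" where
  "total_len I F = (\<Sum>e \<in> F. len I e)"

text \<open>Meaningful only for instances that have a feasible solution.\<close>

definition OPT :: "sf_instance \<Rightarrow> real" where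
  "OPT I = Min (total_len I ` {F. feasible I F})"

definition num_terminals :: "sf_instance \<Rightarrow> nat" where
  "num_terminals I = (\<Sum>S \<leftarrow> terms I. card S)"


section \<open>Input and output encoding\<close>

definition lists_edges :: "(nat \<times> nat) list \<Rightarrow> nat set set \<Rightarrow> bool" where
  "lists_edges es F \<longleftrightarrow>
     distinct (map (\<lambda>(u, v). {u, v}) es) \<and> set (map (\<lambda>(u, v). {u, v}) es) = F"

text \<open>
  An instance is given by its list of vertices, its list of edges with their lengths, and the
  list of its terminal sets; the order of the listings, and of the two ends of an edge, is arbitrary.
\<close>

definition encodes_instance :: "val \<Rightarrow> sf_instance \<Rightarrow> bool" where
  "encodes_instance x I \<longleftrightarrow> (\<exists>vs es Ss.
     distinct vs \<and> set vs = verts I \<and>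
     lists_edges es (edges I) \<and>
     list_all2 (\<lambda>s S. distinct s \<and> set s = S) Ss (terms I) \<and>
     x = val_list
       [val_list (map Vert vs),
        val_list (map (\<lambda>(u, v). val_list [Vert u, Vert v, Num (len I {u, v})]) es),
        val_list (map (\<lambda>s. val_list (map Vert s)) Ss)])"

definition encodes_edges :: "val \<Rightarrow> nat set set \<Rightarrow> bool" where
  "encodes_edges y F \<longleftrightarrow> (\<exists>es.
     lists_edges es F \<and> y = val_list (map (\<lambda>(u, v). val_list [Vert u, Vert v]) es))"

end

theory Submission
  imports Defs
begin

text \<open>
  First merge all terminals into one vertex and let \<open>B\<close> be a minimum spanning forest of the
  result.  Every feasible solution connects all vertices modulo the merged terminals, so \<open>B\<close> costs
  at most \<open>OPT\<close>, and every vertex is linked by \<open>B\<close> to a terminal.  Contracting the components of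
  \<open>B\<close> therefore leaves at most \<open>K\<close> vertices (one if \<open>K = 0\<close>), and of each class of parallel edges only
  a cheapest one matters.  The cheapest set \<open>X\<close> of at most \<open>(K + 1)\<^sup>2\<close> such edges that links each
  terminal set is found by exhaustive search; as the contraction of an optimal solution is a candidate,
  \<open>X\<close> costs at most \<open>OPT\<close> as well.
\<close>

section \<open>Connectivity modulo a labelling\<close>

text \<open>The factor 2 is one \<open>OPT\<close> for each stage. The two stages contract
  differently: merging the terminals only guides the choice of \<open>B\<close> and is then undone,
  because it is not a connection; the second stage contracts \<open>B\<close> alone. Both stages
  accept an edge only if it joins two classes of the current labelling, so \<open>B\<close> followed
  by \<open>X\<close> is acyclic without any cycle test. The machine can only compare vertices for
  equality; contraction is therefore a list of substitutions that grows by one pair per edge, and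
  the graph itself is never rebuilt. Deciding on the candidates one by one gives at most
  \<open>2 ^ ((K + 1) * (K + 1))\<close> leaves. The parameter function
  \<open>2 ^ 2 ^ (K + 2)\<close> is larger, but a very short program computes it in unary. The time
  bound covers every valid instance, also one without a feasible solution.\<close>

abbreviation ends :: "'a \<times> 'a \<Rightarrow> 'a set" where
  "ends e \<equiv> {fst e, snd e}"

text \<open>A labelling of all vertices is stored as a list of substitutions, the last one first.\<close>

fun label :: "('a \<times> 'a) list \<Rightarrow> 'a \<Rightarrow> 'a" where
  "label [] v = v"
| "label (p # c) v = (if label c v = fst p then snd p else label c v)"

text \<open>The stored pair consists of current labels, so that this one substitution renames the
  whole class of the first end.\<close>

definition join :: "('a \<times> 'a) list \<Rightarrow> 'a \<times> 'a \<Rightarrow> ('a \<times> 'a) list" where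
  "join c e = (label c (fst e), label c (snd e)) # c"

text \<open>Connectivity in the graph with edge set \<open>A\<close> after identifying vertices of
  equal label. It specialises to \<open>linked\<close> for the empty labelling and to equality of
  labels for the empty edge set.\<close>

definition conn :: "('a \<times> 'a) list \<Rightarrow> 'a set set \<Rightarrow> ('a \<times> 'a) set" where
  "conn c A = ({(x, y). label c x = label c y} \<union> {(x, y). {x, y} \<in> A})\<^sup>*"

lemma conn_refl [simp]: "(x, x) \<in> conn c A"
  by (simp add: conn_def)

lemma conn_trans: "(x, y) \<in> conn c A \<Longrightarrow> (y, z) \<in> conn c A \<Longrightarrow> (x, z) \<in> conn c A"
  unfolding conn_def by (rule rtrancl_trans)

lemma conn_sym: "(x, y) \<in> conn c A \<Longrightarrow> (y, x) \<in> conn c A"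
proof -
  have "sym (conn c A)"
    unfolding conn_def by (intro sym_rtrancl symI) (auto simp: insert_commute)
  then show "(x, y) \<in> conn c A \<Longrightarrow> (y, x) \<in> conn c A" by (rule symD)
qed

lemma conn_label: "label c x = label c y \<Longrightarrow> (x, y) \<in> conn c A"
  unfolding conn_def by blast

lemma conn_edge: "{x, y} \<in> A \<Longrightarrow> (x, y) \<in> conn c A"
  unfolding conn_def by blast

lemma conn_least:
  assumes "\<And>x y. label c x = label c y \<Longrightarrow> (x, y) \<in> conn d B"
    and "\<And>x y. {x, y} \<in> A \<Longrightarrow> (x, y) \<in> conn d B"
  shows "conn c A \<subseteq> conn d B"
  unfolding conn_def
  by (rule rtrancl_subset_rtrancl) (use assms in \<open>auto simp: conn_def\<close>)

lemma conn_subset: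
  "(\<And>x y. {x, y} \<in> A \<Longrightarrow> (x, y) \<in> conn c B) \<Longrightarrow> conn c A \<subseteq> conn c B"
  by (rule conn_least) (auto intro: conn_label)

lemma conn_mono: "A \<subseteq> B \<Longrightarrow> conn c A \<subseteq> conn c B"
  by (rule conn_subset) (auto intro: conn_edge)

lemma conn_empty: "conn c {} = {(x, y). label c x = label c y}"
proof
  show "conn c {} \<subseteq> {(x, y). label c x = label c y}"
  proof (rule subrelI)
    fix x y assume "(x, y) \<in> conn c {}"
    then have "label c x = label c y"
      unfolding conn_def by (induction rule: rtrancl_induct) auto
    then show "(x, y) \<in> {(x, y). label c x = label c y}" by simp
  qed
qed (auto intro: conn_label)

lemma linked_iff_conn: "linked A x y \<longleftrightarrow> (x, y) \<in> conn [] A"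
proof -
  have "{(x::'a, y). label [] x = label [] y} \<union> {(x, y). {x, y} \<in> A} = {(x, y). {x, y} \<in> A}\<^sup>="
    by auto
  then show ?thesis
    unfolding linked_def conn_def by (metis rtrancl_reflcl)
qed

lemma label_join:
  "label (join c e) x = (if label c x = label c (fst e) then label c (snd e) else label c x)"
  by (simp add: join_def)

text \<open>Contracting an edge affects connectivity exactly as adding it to the edge set does. The
  inductions over edge lists with a growing labelling rest on this trade.\<close>

lemma conn_join: "conn (join c e) A = conn c (insert (ends e) A)" (is "?L = ?R")
proof
  have uv: "(fst e, snd e) \<in> ?R" by (rule conn_edge) simp
  show "?L \<subseteq> ?R"
  proof (rule conn_least)
    fix x y assume xy: "label (join c e) x = label (join c e) y"
    have snd: "(z, snd e) \<in> ?R" if "label c z = label c (fst e)" for z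
      using conn_trans[OF conn_label[OF that] uv] .
    \<comment> \<open>Labels that become equal without having been so belong to the renamed class
      and to the class that gives it its new name.\<close>
    consider "label c x = label c y"
      | "label c x = label c (fst e)" "label c (snd e) = label c y"
      | "label c x = label c (snd e)" "label c y = label c (fst e)"
      using xy unfolding label_join by metis
    then show "(x, y) \<in> ?R"
    proof cases
      case 1
      then show ?thesis by (rule conn_label)
    next
      case 2
      show ?thesis using conn_trans[OF snd[OF 2(1)] conn_label[OF 2(2)]] .
    next
      case 3
      show ?thesis using conn_trans[OF conn_label[OF 3(1)] conn_sym[OF snd[OF 3(2)]]] .
    qed
  qed (auto intro: conn_edge)
  show "?R \<subseteq> ?L"
    by (rule conn_least)
      (auto simp: label_join doubleton_eq_iff intro: conn_label conn_edge)
qed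

lemma conn_insert_label:
  assumes "label c (fst e) = label c (snd e)"
  shows "conn c (insert (ends e) A) = conn c A"
proof
  show "conn c (insert (ends e) A) \<subseteq> conn c A"
  proof (rule conn_subset)
    fix x y assume "{x, y} \<in> insert (ends e) A"
    then have "label c x = label c y \<or> {x, y} \<in> A"
      unfolding insert_iff doubleton_eq_iff using assms by auto
    then show "(x, y) \<in> conn c A" using conn_label conn_edge by metis
  qed
  show "conn c A \<subseteq> conn c (insert (ends e) A)" by (rule conn_mono) blast
qed

text \<open>A walk from \<open>u\<close> to \<open>v\<close> that cannot avoid \<open>{a, b}\<close>
  splits there; going back along its first part, over \<open>{u, v}\<close>, and back along its
  second part connects \<open>a\<close> with \<open>b\<close>.\<close>

lemma conn_exchange_insert:
  assumes "(u, v) \<in> conn c (insert {a, b} A)" "(u, v) \<notin> conn c A"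
  shows "(a, b) \<in> conn c (insert {u, v} A)"
proof -
  let ?R = "conn c A" and ?S = "conn c (insert {u, v} A)"
  \<comment> \<open>A single traversal of \<open>{a, b}\<close> suffices in the invariant: at every
    traversal, \<open>u\<close> already reaches \<open>a\<close> or \<open>b\<close> inside
    \<open>A\<close>, so earlier ones can be cut out.\<close>
  have "(u, v) \<in> ?R \<or> (u, a) \<in> ?R \<and> (b, v) \<in> ?R \<or> (u, b) \<in> ?R \<and> (a, v) \<in> ?R"
    using assms(1) unfolding conn_def[of c "insert _ _"]
  proof (induction rule: rtrancl_induct)
    case (step y z)
    have "label c y = label c z \<or> {y, z} \<in> A \<or> y = a \<and> z = b \<or> y = b \<and> z = a"
      using step.hyps(2) unfolding Un_iff mem_Collect_eq case_prod_conv insert_iff doubleton_eq_iff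
      by blast
    then consider "(y, z) \<in> ?R" | "y = a" "z = b" | "y = b" "z = a"
      using conn_label conn_edge by metis
    then show ?case
    proof cases
      case 1
      then show ?thesis using step.IH conn_trans[OF _ 1] by blast
    next
      case 2
      then show ?thesis using step.IH conn_refl by metis
    next
      case 3
      then show ?thesis using step.IH conn_refl by metis
    qed
  qed simp
  moreover have sub: "?R \<subseteq> ?S" by (rule conn_mono) blast
  moreover have uv: "(u, v) \<in> ?S" by (rule conn_edge) simp
  ultimately consider "(u, a) \<in> ?S" "(b, v) \<in> ?S" | "(u, b) \<in> ?S" "(a, v) \<in> ?S"
    using assms(2) by blast
  then show ?thesis
  proof cases
    case 1
    show ?thesis using conn_trans[OF conn_trans[OF conn_sym[OF 1(1)] uv] conn_sym[OF 1(2)]] .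
  next
    case 2
    show ?thesis using conn_trans[OF conn_trans[OF 2(2) conn_sym[OF uv]] 2(1)] .
  qed
qed

text \<open>Exchange in the graphic matroid of the contracted graph: \<open>{u, v}\<close> closes a
  cycle with edges of \<open>A\<close>, one of which can go. The induction finds it as the edge
  whose insertion first connects \<open>u\<close> with \<open>v\<close>; distinct labels ensure that
  they are not connected from the start.\<close>

lemma conn_exchange:
  assumes "finite A" "(u, v) \<in> conn c A" "label c u \<noteq> label c v" "A \<subseteq> range ends"
  shows "\<exists>g \<in> A. conn c A \<subseteq> conn c (insert {u, v} (A - {g}))"
  using assms
proof (induction A rule: finite_induct)
  case empty
  then show ?case by (simp add: conn_empty)
next
  case (insert g A)
  obtain a b where g: "g = {a, b}" using insert.prems(3) by blast
  have *: "conn c (insert g A) \<subseteq> conn c (insert {u, v} (insert g A - {h}))"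
    if "conn c A \<subseteq> conn c (insert {u, v} (A - {h}))" "h \<noteq> g" for h
  proof (rule conn_subset)
    fix x y assume xy: "{x, y} \<in> insert g A"
    show "(x, y) \<in> conn c (insert {u, v} (insert g A - {h}))"
    proof (cases "{x, y} = g")
      case True
      then have "{x, y} \<in> insert {u, v} (insert g A - {h})" using that(2) by blast
      then show ?thesis by (rule conn_edge)
    next
      case False
      then have "(x, y) \<in> conn c A" using xy conn_edge[of x y A] by blast
      then have "(x, y) \<in> conn c (insert {u, v} (A - {h}))" using that(1) by (rule subsetD[rotated])
      moreover have "insert {u, v} (A - {h}) \<subseteq> insert {u, v} (insert g A - {h})" by blast
      ultimately show ?thesis using subsetD[OF conn_mono] by metis
    qed
  qed
  show ?case
  proof (cases "(u, v) \<in> conn c A")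
    case True
    then obtain h where h: "h \<in> A" "conn c A \<subseteq> conn c (insert {u, v} (A - {h}))"
      using insert.IH[OF _ insert.prems(2)] insert.prems(3) by blast
    then have hg: "h \<noteq> g" using insert.hyps(2) by blast
    show ?thesis using *[OF h(2) hg] h(1) by (rule bexI[OF _ insertI2])
  next
    case False
    have ab: "(a, b) \<in> conn c (insert {u, v} A)"
      using insert.prems(1) unfolding g by (rule conn_exchange_insert[OF _ False])
    have "(x, y) \<in> conn c (insert {u, v} A)" if "{x, y} \<in> insert g A" for x y
      using that ab conn_sym[OF ab] conn_edge[of x y "insert {u, v} A"] unfolding g insert_iff doubleton_eq_iff by blast
    then have "conn c (insert g A) \<subseteq> conn c (insert {u, v} A)" by (rule conn_subset)
    moreover have "insert g A - {g} = A" using insert.hyps(2) by blast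
    ultimately have "conn c (insert g A) \<subseteq> conn c (insert {u, v} (insert g A - {g}))" by simp
    then show ?thesis by (rule bexI[OF _ insertI1])
  qed
qed


section \<open>Forests\<close>

lemma is_cycle_rotate1: "is_cycle F c \<Longrightarrow> is_cycle F (rotate1 c)"
proof -
  assume c: "is_cycle F c"
  then have n: "0 < length c" by (auto simp: is_cycle_def)
  have "{rotate1 c ! i, rotate1 c ! (Suc i mod length c)} \<in> F" if "i < length c" for i
  proof -
    have "Suc i mod length c < length c" using n by simp
    then show ?thesis using that c by (simp add: nth_rotate1 is_cycle_def)
  qed
  then show "is_cycle F (rotate1 c)" using c by (simp add: is_cycle_def)
qed

lemma is_cycle_rotate: "is_cycle F c \<Longrightarrow> is_cycle F (rotate n c)"
  by (induction n) (auto intro: is_cycle_rotate1)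

lemma linked_path:
  assumes "\<And>i. Suc i < length c \<Longrightarrow> {c ! i, c ! Suc i} \<in> F" "i < length c"
  shows "linked F (c ! 0) (c ! i)"
  using assms(2)
proof (induction i)
  case (Suc i)
  then show ?case using assms(1)[of i]
    unfolding linked_def by (auto intro: rtrancl.rtrancl_into_rtrancl)
qed (simp add: linked_def)

lemma linked_sym: "linked F u v \<Longrightarrow> linked F v u"
  by (simp add: linked_iff_conn conn_sym)

text \<open>A cycle of the larger set must use \<open>{u, v}\<close>. Rotated so that this is its
  closing edge, the rest of it is a path in \<open>F\<close> between \<open>u\<close> and
  \<open>v\<close>.\<close>

lemma forest_insert:
  assumes "forest F" "\<not> linked F u v"
  shows "forest (insert {u, v} F)"
  unfolding forest_def
proof
  assume "\<exists>c. is_cycle (insert {u, v} F) c"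
  then obtain c where c: "is_cycle (insert {u, v} F) c" by blast
  have "\<not> is_cycle F c" using assms(1) unfolding forest_def by blast
  then obtain i where i': "i < length c" "{c ! i, c ! (Suc i mod length c)} \<notin> F"
    using c unfolding is_cycle_def by blast
  moreover have "{c ! i, c ! (Suc i mod length c)} \<in> insert {u, v} F"
    using c i'(1) unfolding is_cycle_def by blast
  ultimately have i: "i < length c" "{c ! i, c ! (Suc i mod length c)} = {u, v}" by blast+
  define d where "d = rotate (Suc i) c"
  define n where "n = length d"
  have d: "is_cycle (insert {u, v} F) d" unfolding d_def using c by (rule is_cycle_rotate)
  then have n: "3 \<le> n" "distinct d" unfolding is_cycle_def n_def by auto
  have nc: "n = length c" by (simp add: n_def d_def)
  have rot: "d ! j = c ! ((Suc i + j) mod n)" if "j < n" for j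
    using nth_rotate[OF that[unfolded nc], of "Suc i"] unfolding d_def nc .
  have "Suc i + (n - 1) = i + n" using n(1) by simp
  then have "(Suc i + (n - 1)) mod n = i" using i(1) nc by simp
  then have last: "d ! (n - 1) = c ! i" using rot[of "n - 1"] n(1) by simp
  have first: "d ! 0 = c ! (Suc i mod length c)" using rot[of 0] n(1) unfolding nc[symmetric] by simp
  have uv: "{d ! 0, d ! (n - 1)} = {u, v}"
    unfolding first last i(2)[symmetric] by (rule insert_commute)
  have "{d ! j, d ! Suc j} \<in> F" if j: "Suc j < n" for j
  proof -
    have "\<forall>i < n. {d ! i, d ! (Suc i mod n)} \<in> insert {u, v} F"
      using d unfolding is_cycle_def n_def by blast
    then have "{d ! j, d ! (Suc j mod n)} \<in> insert {u, v} F" using Suc_lessD[OF j] by blast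
    then have "{d ! j, d ! Suc j} \<in> insert {u, v} F" using j by simp
    \<comment> \<open>On at least three distinct vertices, the closing edge of the cycle is not
      traversed a second time.\<close>
    moreover have "{d ! j, d ! Suc j} \<noteq> {d ! 0, d ! (n - 1)}"
    proof
      assume "{d ! j, d ! Suc j} = {d ! 0, d ! (n - 1)}"
      then have "d ! j = d ! 0 \<and> d ! Suc j = d ! (n - 1) \<or> d ! Suc j = d ! 0"
        unfolding doubleton_eq_iff by blast
      moreover have "d ! k = d ! l \<longleftrightarrow> k = l" if "k < n" "l < n" for k l
        using n(2) that unfolding n_def by (rule nth_eq_iff_index_eq)
      ultimately have "j = 0 \<and> Suc j = n - 1 \<or> Suc j = 0"
        using n(1) j Suc_lessD[OF j] by simp
      then show False using n(1) by linarith
    qed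
    ultimately show ?thesis unfolding uv by blast
  qed
  then have "linked F (d ! 0) (d ! (n - 1))"
    using n(1) by (intro linked_path) (simp_all add: n_def)
  then have "linked F u v"
    using uv linked_sym[of F "d ! 0" "d ! (n - 1)"] unfolding doubleton_eq_iff by blast
  then show False using assms(2) by blast
qed

text \<open>Independence in the graphic matroid of the contracted graph, tested in the order in
  which a greedy run accepts the edges.\<close>

fun indep :: "('a \<times> 'a) list \<Rightarrow> ('a \<times> 'a) list \<Rightarrow> bool" where
  "indep c [] \<longleftrightarrow> True"
| "indep c (e # es) \<longleftrightarrow> label c (fst e) \<noteq> label c (snd e) \<and> indep (join c e) es"

text \<open>Refining the labels keeps separate classes separate, also after further joins. This
  serves to forget the merging of the terminals under which the first stage picks its edges.\<close>

lemma indep_coarser: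
  assumes "indep d es" "\<And>x y. label c x = label c y \<Longrightarrow> label d x = label d y"
  shows "indep c es"
  using assms
proof (induction es arbitrary: c d)
  case Nil
  show ?case by (rule indep.simps(1)[THEN iffD2, OF TrueI])
next
  case (Cons e es)
  have "label (join d e) x = label (join d e) y" if xy: "label (join c e) x = label (join c e) y" for x y
  proof -
    consider "label c x = label c y"
      | "label c x = label c (fst e)" "label c (snd e) = label c y"
      | "label c x = label c (snd e)" "label c y = label c (fst e)"
      using xy unfolding label_join by metis
    then show ?thesis
      by cases (drule Cons.prems(2), (drule Cons.prems(2))?, simp add: label_join)+
  qed
  moreover have "indep (join d e) es" using Cons.prems(1) by simp
  ultimately have "indep (join c e) es" by (rule Cons.IH[rotated])
  moreover have "label c (fst e) \<noteq> label c (snd e)"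
    using Cons.prems(1) Cons.prems(2)[of "fst e" "snd e"] by auto
  ultimately show ?case by simp
qed

lemma indep_append: "indep c (xs @ ys) \<longleftrightarrow> indep c xs \<and> indep (foldl join c xs) ys"
  by (induction xs arbitrary: c) simp_all

lemma conn_foldl_join: "conn (foldl join c es) A = conn c (ends ` set es \<union> A)"
  by (induction es arbitrary: c) (simp_all add: conn_join)

lemma label_foldl_join:
  "label (foldl join c es) x = label (foldl join c es) y \<longleftrightarrow> (x, y) \<in> conn c (ends ` set es)"
  using conn_foldl_join[of c es "{}"] unfolding conn_empty by auto

text \<open>\<open>F\<close> stands for the edges contracted so far. Ends with different labels are
  not linked by \<open>F\<close>, so \<open>forest_insert\<close> applies at each edge; the same
  fact rules out that an edge is listed twice.\<close>

lemma indep_forest: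
  assumes "indep c es" "forest F" "\<And>x y. linked F x y \<Longrightarrow> label c x = label c y"
  shows "forest (F \<union> ends ` set es) \<and> distinct (map ends es) \<and> ends ` set es \<inter> F = {}"
  using assms
proof (induction es arbitrary: c F)
  case Nil
  show ?case using Nil.prems(2) by simp
next
  case (Cons e es)
  have 1: "\<not> linked F (fst e) (snd e)"
    using Cons.prems(1) Cons.prems(3)[of "fst e" "snd e"] by auto
  then have e: "ends e \<notin> F"
    unfolding linked_def by blast
  have lab: "label (join c e) x = label (join c e) y" if "linked (insert (ends e) F) x y" for x y
    using that unfolding linked_def
  proof (induction rule: rtrancl_induct)
    case (step y z)
    have "{y, z} = ends e \<or> linked F y z" using step.hyps(2) unfolding linked_def by blast
    then have "label (join c e) y = label (join c e) z"
      unfolding doubleton_eq_iff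
      using Cons.prems(3)[of y z] by (elim disjE conjE) (simp_all add: label_join)
    then show ?case using step.IH by simp
  qed (rule refl)
  have "indep (join c e) es" using Cons.prems(1) by simp
  note IH = Cons.IH[OF this forest_insert[OF Cons.prems(2) 1] lab]
  have "F \<union> ends ` set (e # es) = insert (ends e) F \<union> ends ` set es" by simp
  moreover have "ends e \<notin> ends ` set es" "ends ` set (e # es) \<inter> F = {}" using IH e by auto
  ultimately show ?case using IH by (simp del: Un_insert_right Un_insert_left)
qed


section \<open>The greedy spanning forest\<close>

fun greedy :: "('a \<times> 'a) list \<Rightarrow> ('a \<times> 'a) list \<Rightarrow> ('a \<times> 'a) list" where
  "greedy c [] = []"
| "greedy c (e # es) =
    (if label c (fst e) = label c (snd e) then greedy c es else e # greedy (join c e) es)"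

lemma set_greedy: "set (greedy c es) \<subseteq> set es"
  by (induction es arbitrary: c) auto

lemma length_greedy: "length (greedy c es) \<le> length es"
  by (induction es arbitrary: c) (auto intro: le_SucI)

lemma indep_greedy: "indep c (greedy c es)"
  by (induction es arbitrary: c) auto

lemma conn_greedy: "conn c (ends ` set (greedy c es)) = conn c (ends ` set es)"
proof (induction es arbitrary: c)
  case (Cons e es)
  show ?case
  proof (cases "label c (fst e) = label c (snd e)")
    case True
    then show ?thesis using Cons by (simp add: conn_insert_label)
  next
    case False
    then show ?thesis using Cons[of "join c e"] by (simp add: conn_join)
  qed
qed simp

text \<open>Kruskal's argument. The first edge \<open>e\<close> that is no loop after contraction is
  a cheapest one left; if \<open>A\<close> lacks it, exchanging some \<open>g\<close> of
  \<open>A\<close> for it does not raise the cost, and then both sides contract \<open>e\<close>.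
  Loops of \<open>A\<close> are dropped, which cannot raise the cost since weights are
  nonnegative.\<close>

lemma greedy_optimal:
  fixes w :: "'a set \<Rightarrow> real"
  assumes "sorted (map (\<lambda>e. w (ends e)) es)" "\<And>e. e \<in> set es \<Longrightarrow> 0 \<le> w (ends e)"
    and "A \<subseteq> ends ` set es" "conn c (ends ` set es) \<subseteq> conn c A"
  shows "(\<Sum>e \<leftarrow> greedy c es. w (ends e)) \<le> sum w A"
  using assms
proof (induction es arbitrary: c A)
  case Nil
  then show ?case by simp
next
  case (Cons e es)
  have fin: "finite A" using Cons.prems(3) finite_subset by blast
  have nonneg: "0 \<le> w a" if "a \<in> A" for a using Cons.prems(2,3) that by auto
  show ?case
  proof (cases "label c (fst e) = label c (snd e)")
    case True
    have "conn c (ends ` set es) \<subseteq> conn c A"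
      using Cons.prems(4) by (simp add: conn_insert_label[OF True])
    also have "conn c A = conn c (insert (ends e) (A - {ends e}))"
      by (simp add: conn_insert_label[OF True] insert_Diff_if insert_absorb)
    also have "\<dots> = conn c (A - {ends e})" by (rule conn_insert_label[OF True])
    finally have "(\<Sum>e \<leftarrow> greedy c es. w (ends e)) \<le> sum w (A - {ends e})"
      using Cons.prems by (intro Cons.IH) auto
    also have "\<dots> \<le> sum w A" using fin nonneg by (intro sum_mono2) auto
    finally show ?thesis using True by simp
  next
    case False
    have sub: "conn c (ends ` set (e # es)) \<subseteq> conn c A" by (rule Cons.prems(4))
    \<comment> \<open>If \<open>A\<close> already contains \<open>e\<close>, then \<open>e\<close>
      is exchanged for itself; otherwise \<open>g\<close> stands further down the sorted list and is
      no cheaper.\<close>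
    obtain g where g: "g \<in> A" "conn c A \<subseteq> conn c (insert (ends e) (A - {g}))" "w (ends e) \<le> w g"
      "A - {g} \<subseteq> ends ` set es"
    proof (cases "ends e \<in> A")
      case True
      then show ?thesis using that[of "ends e"] Cons.prems(3) by (auto simp: insert_absorb)
    next
      case notin: False
      have "(fst e, snd e) \<in> conn c A" using sub conn_edge[of "fst e" "snd e"] by auto
      then obtain g where "g \<in> A" "conn c A \<subseteq> conn c (insert (ends e) (A - {g}))"
        using conn_exchange[OF fin _ False] Cons.prems(3) by blast
      moreover have "A \<subseteq> ends ` set es" using notin Cons.prems(3) by auto
      moreover have "w (ends e) \<le> w g" using \<open>g \<in> A\<close> \<open>A \<subseteq> ends ` set es\<close> Cons.prems(1) by auto
      ultimately show ?thesis using that by blast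
    qed
    have "conn c (insert (ends e) (ends ` set es)) \<subseteq> conn c (insert (ends e) (A - {g}))"
      using sub g(2) by simp
    then have "(\<Sum>e \<leftarrow> greedy (join c e) es. w (ends e)) \<le> sum w (A - {g})"
      using Cons.prems g(4) by (intro Cons.IH) (auto simp: conn_join)
    then show ?thesis using False g(1,3) fin by (simp add: sum_diff1)
  qed
qed


section \<open>Exhaustive search over parallel classes\<close>

text \<open>The ends are compared in their listed order, so a reversed copy of an edge forms a class
  of its own. This is why candidates are counted by ordered pairs of labels.\<close>

definition parallel :: "('a \<times> 'a) list \<Rightarrow> 'a \<times> 'a \<Rightarrow> 'a \<times> 'a \<Rightarrow> bool" where
  "parallel c e e' \<longleftrightarrow> label c (fst e) = label c (fst e') \<and> label c (snd e) = label c (snd e')"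

fun dedupe :: "('a \<times> 'a) list \<Rightarrow> ('a \<times> 'a) list \<Rightarrow> ('a \<times> 'a) list" where
  "dedupe c [] = []"
| "dedupe c (e # es) = (if label c (fst e) = label c (snd e) then dedupe c es else
     e # filter (\<lambda>e'. \<not> parallel c e e') (dedupe c es))"

lemma set_dedupe: "set (dedupe c es) \<subseteq> set es"
  by (induction es) auto

lemma length_dedupe: "length (dedupe c es) \<le> length es"
  by (induction es) (auto intro: le_trans[OF length_filter_le] le_SucI)

lemma distinct_dedupe: "distinct (map (\<lambda>e. (label c (fst e), label c (snd e))) (dedupe c es))"
  by (induction es) (auto simp: distinct_map_filter parallel_def)

lemma length_dedupe_le:
  assumes "\<And>e. e \<in> set es \<Longrightarrow> label c (fst e) \<in> L \<and> label c (snd e) \<in> L" "finite L"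
  shows "length (dedupe c es) \<le> card L * card L"
proof -
  let ?ks = "map (\<lambda>e. (label c (fst e), label c (snd e))) (dedupe c es)"
  have "length ?ks = card (set ?ks)" using distinct_card[OF distinct_dedupe] by metis
  also have "\<dots> \<le> card (L \<times> L)"
    using assms set_dedupe[of c es] by (intro card_mono) auto
  finally show ?thesis using assms by (simp add: card_cartesian_product)
qed

text \<open>As the list is sorted, the edge kept for a class is its first and hence a cheapest
  one.\<close>

lemma dedupe_representative:
  fixes w :: "'a set \<Rightarrow> real"
  assumes "sorted (map (\<lambda>e. w (ends e)) es)" "e \<in> set es" "label c (fst e) \<noteq> label c (snd e)"
  shows "\<exists>e' \<in> set (dedupe c es). label c (fst e') = label c (fst e) \<and>
    label c (snd e') = label c (snd e) \<and> w (ends e') \<le> w (ends e)"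
  using assms
proof (induction es)
  case (Cons x es)
  show ?case
  proof (cases "e = x")
    case True
    then show ?thesis using Cons.prems(3) by auto
  next
    case False
    then obtain e' where e': "e' \<in> set (dedupe c es)" "label c (fst e') = label c (fst e)"
      "label c (snd e') = label c (snd e)" "w (ends e') \<le> w (ends e)"
      using Cons by auto
    have "w (ends x) \<le> w (ends e)" using Cons.prems False by auto
    \<comment> \<open>If \<open>x\<close> is parallel to \<open>e'\<close>, then \<open>e'\<close>
      is filtered out and \<open>x\<close> takes its place.\<close>
    then show ?thesis using e' by (cases "parallel c x e'") (auto simp: parallel_def)
  qed
qed simp

text \<open>Replace each edge of \<open>A\<close> by the representative of its class and drop loops:
  the labels at the ends stay the same, which preserves connectivity modulo \<open>c\<close>, and no
  replacement costs more.\<close>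

lemma dedupe_cheapest:
  fixes w :: "'a set \<Rightarrow> real"
  assumes sorted: "sorted (map (\<lambda>e. w (ends e)) es)" and nonneg: "\<And>e. e \<in> set es \<Longrightarrow> 0 \<le> w (ends e)"
    and dist: "distinct (map ends es)" and A: "A \<subseteq> ends ` set es"
  shows "\<exists>A' \<subseteq> ends ` set (dedupe c es). conn c A \<subseteq> conn c A' \<and> sum w A' \<le> sum w A"
proof -
  define D where "D = {e \<in> set es. ends e \<in> A \<and> label c (fst e) \<noteq> label c (snd e)}"
  have "\<forall>e \<in> D. \<exists>e' \<in> set (dedupe c es). label c (fst e') = label c (fst e) \<and>
    label c (snd e') = label c (snd e) \<and> w (ends e') \<le> w (ends e)"
    using dedupe_representative[OF sorted] unfolding D_def by blast
  then obtain r where r: "\<And>e. e \<in> D \<Longrightarrow> r e \<in> set (dedupe c es) \<and> label c (fst (r e)) = label c (fst e) \<and>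
    label c (snd (r e)) = label c (snd e) \<and> w (ends (r e)) \<le> w (ends e)" by metis
  have finD: "finite D" unfolding D_def by simp
  have rD: "r e \<in> set es" if "e \<in> D" for e using r[OF that] set_dedupe[of c es] by auto
  define A' where "A' = (\<lambda>e. ends (r e)) ` D"
  \<comment> \<open>Edges of \<open>D\<close> may share a representative, which then counts once on
    the left; nonnegativity gives the inequality.\<close>
  have "sum w A' \<le> (\<Sum>e\<in>D. w (ends (r e)))"
    unfolding A'_def using finD nonneg rD sum_image_le[of D w "\<lambda>e. ends (r e)"] by (simp add: comp_def)
  also have "\<dots> \<le> (\<Sum>e\<in>D. w (ends e))" using r by (intro sum_mono) auto
  also have "\<dots> = sum w (ends ` D)"
  proof -
    have "inj_on ends D" using dist unfolding D_def distinct_map by (auto intro: inj_on_subset)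
    then show ?thesis by (simp add: sum.reindex)
  qed
  also have "\<dots> \<le> sum w A"
    using A nonneg finite_subset[OF A] by (intro sum_mono2) (auto simp: D_def)
  finally have "sum w A' \<le> sum w A" .
  moreover have "conn c A \<subseteq> conn c A'"
  proof (rule conn_subset)
    fix x y assume xy: "{x, y} \<in> A"
    then obtain e where e: "e \<in> set es" "ends e = {x, y}" using A by auto
    have "(fst e, snd e) \<in> conn c A'"
    proof (cases "e \<in> D")
      case True
      have "(fst (r e), snd (r e)) \<in> conn c A'" unfolding A'_def by (rule conn_edge) (use True in auto)
      then show ?thesis using r[OF True] by (metis conn_label conn_trans)
    next
      case False
      then have "label c (fst e) = label c (snd e)" using e xy unfolding D_def by simp
      then show ?thesis by (rule conn_label)
    qed
    then show "(x, y) \<in> conn c A'" using e(2) conn_sym by (metis doubleton_eq_iff)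
  qed
  moreover have "A' \<subseteq> ends ` set (dedupe c es)" using r unfolding A'_def by auto
  ultimately show ?thesis by blast
qed

text \<open>Comparing neighbours is enough because equality is transitive. The program evaluates
  this one-pass form, and \<open>agree_iff\<close> recovers all pairs.\<close>

definition agree :: "('a \<times> 'a) list \<Rightarrow> 'a list list \<Rightarrow> bool" where
  "agree c Ss \<longleftrightarrow> (\<forall>s \<in> set Ss. successively (\<lambda>u v. label c u = label c v) s)"

lemma successively_eq: "successively (\<lambda>u v. f u = f v) (x # s) \<longleftrightarrow> (\<forall>v \<in> set s. f v = f x)"
  by (induction s arbitrary: x) auto

lemma successively_label:
  "successively (\<lambda>u v. label c u = label c v) s \<longleftrightarrow>
    (\<forall>u \<in> set s. \<forall>v \<in> set s. label c u = label c v)"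
proof (cases s)
  case (Cons x xs)
  show ?thesis
    unfolding Cons successively_eq
  proof
    assume *: "\<forall>v \<in> set xs. label c v = label c x"
    have "label c v = label c x" if "v \<in> set (x # xs)" for v using * that by auto
    then show "\<forall>u \<in> set (x # xs). \<forall>v \<in> set (x # xs). label c u = label c v" by metis
  next
    assume *: "\<forall>u \<in> set (x # xs). \<forall>v \<in> set (x # xs). label c u = label c v"
    show "\<forall>v \<in> set xs. label c v = label c x"
      by (intro ballI *[rule_format]) simp_all
  qed
qed simp

lemma agree_iff: "agree c Ss \<longleftrightarrow> (\<forall>s \<in> set Ss. \<forall>u \<in> set s. \<forall>v \<in> set s. label c u = label c v)"
  by (simp add: agree_def successively_label)

text \<open>\<open>None\<close> acts as infinite cost: no selection on that branch links every
  terminal set.\<close>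

fun better :: "(real \<times> 'b) option \<Rightarrow> (real \<times> 'b) option \<Rightarrow> (real \<times> 'b) option" where
  "better None r = r"
| "better (Some a) None = Some a"
| "better (Some a) (Some b) = (if fst a \<le> fst b then Some a else Some b)"

fun add_edge :: "('a set \<Rightarrow> real) \<Rightarrow> 'a \<times> 'a \<Rightarrow> (real \<times> ('a \<times> 'a) list) option \<Rightarrow> (real \<times> ('a \<times> 'a) list) option" where
  "add_edge w e None = None"
| "add_edge w e (Some r) = Some (w (ends e) + fst r, e # snd r)"

text \<open>Never taking a loop keeps every returned selection independent, so that its union with
  \<open>B\<close> needs no check for cycles. Terminal sets are inspected only at the leaves, where
  the labelling records the whole selection.\<close>

fun solve :: "('a set \<Rightarrow> real) \<Rightarrow> 'a list list \<Rightarrow> ('a \<times> 'a) list \<Rightarrow> ('a \<times> 'a) list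
    \<Rightarrow> (real \<times> ('a \<times> 'a) list) option" where
  "solve w Ss c [] = (if agree c Ss then Some (0, []) else None)"
| "solve w Ss c (e # es) = (if label c (fst e) = label c (snd e) then solve w Ss c es
     else better (solve w Ss c es) (add_edge w e (solve w Ss (join c e) es)))"

lemma better_eq_Some: "better r s = Some a \<Longrightarrow> r = Some a \<or> s = Some a"
  by (cases r; cases s) (auto split: if_splits)

lemma better_le:
  assumes "r = Some a \<or> s = Some a" "fst a \<le> x"
  shows "\<exists>b. better r s = Some b \<and> fst b \<le> x"
  using assms by (cases r; cases s) (auto split: if_splits)

lemma solve_sound:
  "solve w Ss c es = Some (r, X) \<Longrightarrow> indep c X \<and> set X \<subseteq> set es \<and>
    r = (\<Sum>e \<leftarrow> X. w (ends e)) \<and> agree (foldl join c X) Ss"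
proof (induction es arbitrary: c r X)
  case (Cons e es)
  have "solve w Ss c es = Some (r, X) \<or> label c (fst e) \<noteq> label c (snd e) \<and>
      add_edge w e (solve w Ss (join c e) es) = Some (r, X)"
    using Cons.prems better_eq_Some[of "solve w Ss c es" "add_edge w e (solve w Ss (join c e) es)" "(r, X)"]
    by (cases "label c (fst e) = label c (snd e)") simp_all
  then show ?case
  proof (elim disjE conjE)
    assume "solve w Ss c es = Some (r, X)"
    from Cons.IH[OF this] show ?case unfolding list.set by blast
  next
    assume ne: "label c (fst e) \<noteq> label c (snd e)"
      and "add_edge w e (solve w Ss (join c e) es) = Some (r, X)"
    then obtain q where q: "solve w Ss (join c e) es = Some q"
      "r = w (ends e) + fst q" "X = e # snd q"
      by (cases "solve w Ss (join c e) es") simp_all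
    then have "solve w Ss (join c e) es = Some (fst q, snd q)" by simp
    from Cons.IH[OF this] have "indep (join c e) (snd q)" "set (snd q) \<subseteq> set es"
      "fst q = (\<Sum>e \<leftarrow> snd q. w (ends e))" "agree (foldl join (join c e) (snd q)) Ss"
      by blast+
    then show ?case unfolding q(2,3) using ne by (simp add: subset_insertI2)
  qed
next
  case Nil
  then show ?case by (cases "agree c Ss") simp_all
qed

text \<open>Follow the branch that contracts exactly those edges of \<open>A\<close> that are not
  loops when their turn comes. The omitted ones add nothing to connectivity, and by nonnegativity
  leaving them out only lowers the cost.\<close>

lemma solve_optimal:
  assumes "\<And>e. e \<in> set es \<Longrightarrow> 0 \<le> w (ends e)" "A \<subseteq> ends ` set es"
    and "\<And>s u v. s \<in> set Ss \<Longrightarrow> u \<in> set s \<Longrightarrow> v \<in> set s \<Longrightarrow> (u, v) \<in> conn c A"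
  shows "\<exists>r. solve w Ss c es = Some r \<and> fst r \<le> sum w A"
  using assms
proof (induction es arbitrary: c A)
  case Nil
  have A: "A = {}" using Nil.prems(2) by simp
  have "agree c Ss"
    unfolding agree_iff using Nil.prems(3) unfolding A conn_empty by blast
  then show ?case unfolding A by simp
next
  case (Cons e es)
  have fin: "finite A" using Cons.prems(2) finite_subset by blast
  have nonneg: "\<And>e. e \<in> set es \<Longrightarrow> 0 \<le> w (ends e)" using Cons.prems(1) by simp
  have sub: "A - {ends e} \<subseteq> ends ` set es" using Cons.prems(2) by auto
  have "0 \<le> w a" if "a \<in> A" for a
    using Cons.prems(1,2) that by blast
  then have le: "sum w (A - {ends e}) \<le> sum w A"
    using fin by (intro sum_mono2) simp_all
  show ?case
  proof (cases "label c (fst e) = label c (snd e)")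
    case same: True
    have "conn c A \<subseteq> conn c (insert (ends e) (A - {ends e}))" by (rule conn_mono) blast
    then have sub': "conn c A \<subseteq> conn c (A - {ends e})" unfolding conn_insert_label[OF same] .
    have "\<exists>r. solve w Ss c es = Some r \<and> fst r \<le> sum w (A - {ends e})"
      by (rule Cons.IH[OF nonneg sub subsetD[OF sub' Cons.prems(3)]])
    then obtain r where "solve w Ss c es = Some r" "fst r \<le> sum w (A - {ends e})" by blast
    then show ?thesis using same le by simp
  next
    case ne: False
    show ?thesis
    proof (cases "ends e \<in> A")
      case True
      have eq: "conn (join c e) (A - {ends e}) = conn c A"
        unfolding conn_join insert_Diff[OF True] ..
      have "\<exists>r. solve w Ss (join c e) es = Some r \<and> fst r \<le> sum w (A - {ends e})"
      proof (rule Cons.IH[OF nonneg sub])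
        fix s u v assume "s \<in> set Ss" "u \<in> set s" "v \<in> set s"
        then show "(u, v) \<in> conn (join c e) (A - {ends e})"
          unfolding eq by (rule Cons.prems(3))
      qed
      then obtain q where q: "solve w Ss (join c e) es = Some q" "fst q \<le> sum w (A - {ends e})"
        by blast
      have "fst (w (ends e) + fst q, e # snd q) \<le> sum w A"
        using q(2) True fin by (simp add: sum_diff1)
      from better_le[OF disjI2 this] show ?thesis using ne q(1) by simp
    next
      case False
      then have A: "A \<subseteq> ends ` set es" using sub by blast
      have "\<exists>r. solve w Ss c es = Some r \<and> fst r \<le> sum w A"
        by (rule Cons.IH, erule nonneg, rule A, rule Cons.prems(3))
      then obtain r where r: "solve w Ss c es = Some r" "fst r \<le> sum w A" by blast
      from better_le[OF disjI1 r(2)] show ?thesis using ne r(1) by simp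
    qed
  qed
qed


section \<open>Evaluation with time bounds\<close>

text \<open>An upper bound in place of the exact step count lets branches of different cost share
  one estimate.\<close>

definition ev :: "program \<Rightarrow> val list \<Rightarrow> exp \<Rightarrow> val \<Rightarrow> nat \<Rightarrow> bool" where
  "ev P env e v b \<longleftrightarrow> (\<exists>t \<le> b. eval P env e v t)"

definition evs :: "program \<Rightarrow> val list \<Rightarrow> exp list \<Rightarrow> val list \<Rightarrow> nat \<Rightarrow> bool" where
  "evs P env es vs b \<longleftrightarrow> (\<exists>t \<le> b. evals P env es vs t)"

text \<open>The cost of the body alone; evaluating the arguments and the call itself are charged in
  \<open>ev_Call\<close>.\<close>

definition fn :: "program \<Rightarrow> nat \<Rightarrow> val list \<Rightarrow> val \<Rightarrow> nat \<Rightarrow> bool" where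
  "fn P i vs v b \<longleftrightarrow> i < length P \<and> ev P vs (P ! i) v b"

lemma fn_weaken: "fn P i vs v b \<Longrightarrow> b \<le> b' \<Longrightarrow> fn P i vs v b'"
  unfolding fn_def ev_def using le_trans by blast

text \<open>The bound \<open>b\<close> stays open at first: applying \<open>ev_intros\<close> to the
  body computes its value and its bound together, and only then is \<open>b\<close> compared with
  the claimed \<open>b'\<close>. The constants in the claims are generous roundings of what
  arises.\<close>

lemma fnI: "i < length P \<Longrightarrow> ev P vs (P ! i) v b \<Longrightarrow> b \<le> b' \<Longrightarrow> fn P i vs v b'"
  unfolding fn_def ev_def using le_trans by blast

lemma ev_Var: "i < length env \<Longrightarrow> env ! i = v \<Longrightarrow> ev P env (Var i) v 1"
  unfolding ev_def by (hypsubst, rule exI, rule conjI[rotated], erule eval_evals.Var, rule order.refl)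

lemma ev_NulE: "ev P env NulE Nul 1"
  unfolding ev_def by (rule exI, rule conjI[rotated], rule eval_evals.NulE, rule order.refl)

lemma ev_Zero: "ev P env Zero (Num 0) 1"
  unfolding ev_def by (rule exI, rule conjI[rotated], rule eval_evals.Zero, rule order.refl)

lemma ev_CellE: "ev P env a v s \<Longrightarrow> ev P env b w t \<Longrightarrow> ev P env (CellE a b) (Cell v w) (s + t + 1)"
  unfolding ev_def evs_def fn_def
  by (elim exE conjE, rule exI, rule conjI[rotated], rule eval_evals.CellE, assumption, assumption, linarith)

lemma ev_Fst: "ev P env a v t \<Longrightarrow> val_fst v = w \<Longrightarrow> ev P env (Fst a) w (t + 1)"
  unfolding ev_def evs_def fn_def
  by (hypsubst, elim exE conjE, rule exI, rule conjI[rotated], rule eval_evals.Fst, assumption, linarith)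

lemma ev_Snd: "ev P env a v t \<Longrightarrow> val_snd v = w \<Longrightarrow> ev P env (Snd a) w (t + 1)"
  unfolding ev_def evs_def fn_def
  by (hypsubst, elim exE conjE, rule exI, rule conjI[rotated], rule eval_evals.Snd, assumption, linarith)

lemma ev_SameVert: "ev P env a v s \<Longrightarrow> ev P env b w t \<Longrightarrow> val_same_vert v w = r
    \<Longrightarrow> ev P env (SameVert a b) r (s + t + 1)"
  unfolding ev_def evs_def fn_def
  by (hypsubst, elim exE conjE, rule exI, rule conjI[rotated], rule eval_evals.SameVert, assumption, assumption, linarith)

lemma ev_Plus: "ev P env a v s \<Longrightarrow> ev P env b w t \<Longrightarrow> val_plus v w = r
    \<Longrightarrow> ev P env (Plus a b) r (s + t + 1)"
  unfolding ev_def evs_def fn_def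
  by (hypsubst, elim exE conjE, rule exI, rule conjI[rotated], rule eval_evals.Plus, assumption, assumption, linarith)

lemma ev_LessEq: "ev P env a v s \<Longrightarrow> ev P env b w t \<Longrightarrow> val_less_eq v w = r
    \<Longrightarrow> ev P env (LessEq a b) r (s + t + 1)"
  unfolding ev_def evs_def fn_def
  by (hypsubst, elim exE conjE, rule exI, rule conjI[rotated], rule eval_evals.LessEq, assumption, assumption, linarith)

text \<open>One rule for both branches: once the value \<open>u\<close> of the test is known, the
  simplifier selects the branch.\<close>

lemma ev_Cond:
  assumes "ev P env c u s" "if u = Nul then ev P env b v t else ev P env a v t"
  shows "ev P env (Cond c a b) v (s + t + 1)"
proof -
  obtain s' where s: "s' \<le> s" "eval P env c u s'" using assms(1) unfolding ev_def by blast
  obtain t' where t: "t' \<le> t" "eval P env (if u = Nul then b else a) v t'"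
    using assms(2) unfolding ev_def by (cases "u = Nul") auto
  have "eval P env (Cond c a b) v (s' + t' + 1)"
  proof (cases "u = Nul")
    case True
    then show ?thesis using eval_evals.CondF[OF s(2)[unfolded True]] t(2) by simp
  next
    case False
    then show ?thesis using eval_evals.CondT[OF s(2)] t(2) by simp
  qed
  moreover have "s' + t' + 1 \<le> s + t + 1" using s(1) t(1) by simp
  ultimately show ?thesis unfolding ev_def by blast
qed

lemma evs_Nil: "evs P env [] [] 0"
  unfolding evs_def by (rule exI, rule conjI[rotated], rule eval_evals.Nil, rule order.refl)

lemma evs_Cons: "ev P env a v s \<Longrightarrow> evs P env as vs t \<Longrightarrow> evs P env (a # as) (v # vs) (s + t)"
  unfolding ev_def evs_def fn_def
  by (elim exE conjE, rule exI, rule conjI[rotated], rule eval_evals.Cons, assumption, assumption, linarith)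

lemma ev_Call: "evs P env as vs s \<Longrightarrow> fn P i vs v t \<Longrightarrow> ev P env (Call i as) v (s + t + 1)"
  unfolding ev_def evs_def fn_def
  by (elim exE conjE, rule exI, rule conjI[rotated], rule eval_evals.Call, assumption, assumption, assumption, linarith)

lemmas ev_intros = ev_Var ev_NulE ev_Zero ev_CellE ev_Fst ev_Snd ev_SameVert ev_Plus ev_LessEq
  ev_Cond evs_Nil evs_Cons ev_Call


section \<open>The program\<close>

abbreviation "stage1C Ss es ts \<equiv> Call 1 [Ss, es, ts]"
abbreviation "concatC xss \<equiv> Call 2 [xss]"
abbreviation "insertC e es \<equiv> Call 3 [e, es]"
abbreviation "sortC es \<equiv> Call 4 [es]"
abbreviation "starC ts t \<equiv> Call 5 [ts, t]"
abbreviation "substC p v \<equiv> Call 6 [p, v]"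
abbreviation "labelC c v \<equiv> Call 7 [c, v]"
abbreviation "loopC c e \<equiv> Call 8 [c, e]"
abbreviation "joinC c e \<equiv> Call 9 [c, e]"
abbreviation "greedyC c es \<equiv> Call 10 [c, es]"
abbreviation "joinsC c es \<equiv> Call 11 [c, es]"
abbreviation "parallelC c e e' \<equiv> Call 12 [c, e, e']"
abbreviation "filterC c e es \<equiv> Call 13 [c, e, es]"
abbreviation "dedupeC c es \<equiv> Call 14 [c, es]"
abbreviation "constC c s \<equiv> Call 15 [c, s]"
abbreviation "agreeC c Ss \<equiv> Call 16 [c, Ss]"
abbreviation "betterC r s \<equiv> Call 17 [r, s]"
abbreviation "addC e r \<equiv> Call 18 [e, r]"
abbreviation "solveC Ss c es \<equiv> Call 19 [Ss, c, es]"
abbreviation "stripC es \<equiv> Call 20 [es]"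
abbreviation "appendC xs ys \<equiv> Call 21 [xs, ys]"
abbreviation "stage2C Ss es b \<equiv> Call 22 [Ss, es, b]"
abbreviation "stage3C Ss es c \<equiv> Call 23 [Ss, es, c]"

abbreviation "lengthE e \<equiv> Fst (Snd (Snd e))"

text \<open>The language has no local binding, so the stages are separate functions: passing an
  intermediate result as an argument evaluates it once and names it. A test on a list asks whether
  it is nonempty, since \<open>Nul\<close> is both false and the empty list.\<close>

definition prog :: program where
  "prog = [
    stage1C (Fst (Snd (Snd (Var 0)))) (sortC (Fst (Snd (Var 0)))) (concatC (Fst (Snd (Snd (Var 0))))),
    stage2C (Var 0) (Var 1) (greedyC (starC (Var 2) (Fst (Var 2))) (Var 1)),
    Cond (Var 0) (appendC (Fst (Var 0)) (concatC (Snd (Var 0)))) NulE,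
    Cond (Var 1)
      (Cond (LessEq (lengthE (Var 0)) (lengthE (Fst (Var 1))))
        (CellE (Var 0) (Var 1))
        (CellE (Fst (Var 1)) (insertC (Var 0) (Snd (Var 1)))))
      (CellE (Var 0) NulE),
    Cond (Var 0) (insertC (Fst (Var 0)) (sortC (Snd (Var 0)))) NulE,
    Cond (Var 0) (CellE (CellE (Fst (Var 0)) (Var 1)) (starC (Snd (Var 0)) (Var 1))) NulE,
    Cond (SameVert (Var 1) (Fst (Var 0))) (Snd (Var 0)) (Var 1),
    Cond (Var 0) (substC (Fst (Var 0)) (labelC (Snd (Var 0)) (Var 1))) (Var 1),
    SameVert (labelC (Var 0) (Fst (Var 1))) (labelC (Var 0) (Fst (Snd (Var 1)))),
    CellE (CellE (labelC (Var 0) (Fst (Var 1))) (labelC (Var 0) (Fst (Snd (Var 1))))) (Var 0),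
    Cond (Var 1)
      (Cond (loopC (Var 0) (Fst (Var 1)))
        (greedyC (Var 0) (Snd (Var 1)))
        (CellE (Fst (Var 1)) (greedyC (joinC (Var 0) (Fst (Var 1))) (Snd (Var 1)))))
      NulE,
    Cond (Var 1) (joinsC (joinC (Var 0) (Fst (Var 1))) (Snd (Var 1))) (Var 0),
    Cond (SameVert (labelC (Var 0) (Fst (Var 1))) (labelC (Var 0) (Fst (Var 2))))
      (SameVert (labelC (Var 0) (Fst (Snd (Var 1)))) (labelC (Var 0) (Fst (Snd (Var 2)))))
      NulE,
    Cond (Var 2)
      (Cond (parallelC (Var 0) (Var 1) (Fst (Var 2)))
        (filterC (Var 0) (Var 1) (Snd (Var 2)))
        (CellE (Fst (Var 2)) (filterC (Var 0) (Var 1) (Snd (Var 2)))))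
      NulE,
    Cond (Var 1)
      (Cond (loopC (Var 0) (Fst (Var 1)))
        (dedupeC (Var 0) (Snd (Var 1)))
        (CellE (Fst (Var 1)) (filterC (Var 0) (Fst (Var 1)) (dedupeC (Var 0) (Snd (Var 1))))))
      NulE,
    Cond (Snd (Var 1))
      (Cond (SameVert (labelC (Var 0) (Fst (Var 1))) (labelC (Var 0) (Fst (Snd (Var 1)))))
        (constC (Var 0) (Snd (Var 1)))
        NulE)
      (CellE NulE NulE),
    Cond (Var 1)
      (Cond (constC (Var 0) (Fst (Var 1))) (agreeC (Var 0) (Snd (Var 1))) NulE)
      (CellE NulE NulE),
    Cond (Var 0)
      (Cond (Var 1)
        (Cond (LessEq (Fst (Var 0)) (Fst (Var 1))) (Var 0) (Var 1))
        (Var 0))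
      (Var 1),
    Cond (Var 1)
      (CellE (Plus (lengthE (Var 0)) (Fst (Var 1))) (CellE (Var 0) (Snd (Var 1))))
      NulE,
    Cond (Var 2)
      (Cond (loopC (Var 1) (Fst (Var 2)))
        (solveC (Var 0) (Var 1) (Snd (Var 2)))
        (betterC (solveC (Var 0) (Var 1) (Snd (Var 2)))
          (addC (Fst (Var 2)) (solveC (Var 0) (joinC (Var 1) (Fst (Var 2))) (Snd (Var 2))))))
      (Cond (agreeC (Var 1) (Var 0)) (CellE Zero NulE) NulE),
    Cond (Var 0)
      (CellE (CellE (Fst (Fst (Var 0))) (CellE (Fst (Snd (Fst (Var 0)))) NulE)) (stripC (Snd (Var 0))))
      NulE,
    Cond (Var 0) (CellE (Fst (Var 0)) (appendC (Snd (Var 0)) (Var 1))) (Var 1),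
    stripC (appendC (Var 2) (Snd (stage3C (Var 0) (Var 1) (joinsC NulE (Var 2))))),
    solveC (Var 0) (Var 2) (dedupeC (Var 2) (Var 1))]"

lemma length_prog: "length prog = 24"
  by (simp add: prog_def)

text \<open>Restricted to lookups, so that simplification exposes one body at a time and leaves
  \<open>prog\<close> folded inside calls.\<close>

lemmas prog_nth = arg_cong[OF prog_def, of "\<lambda>P. P ! i" for i]

section \<open>Encoding of edges, labellings and search results as trees\<close>

fun enc_edge :: "(nat set \<Rightarrow> real) \<Rightarrow> nat \<times> nat \<Rightarrow> val" where
  "enc_edge w (u, v) = Cell (Vert u) (Cell (Vert v) (Cell (Num (w {u, v})) Nul))"

abbreviation enc_edges :: "(nat set \<Rightarrow> real) \<Rightarrow> (nat \<times> nat) list \<Rightarrow> val" where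
  "enc_edges w es \<equiv> val_list (map (enc_edge w) es)"

abbreviation enc_verts :: "nat list \<Rightarrow> val" where
  "enc_verts s \<equiv> val_list (map Vert s)"

abbreviation enc_sets :: "nat list list \<Rightarrow> val" where
  "enc_sets Ss \<equiv> val_list (map enc_verts Ss)"

fun enc_pair :: "nat \<times> nat \<Rightarrow> val" where
  "enc_pair (u, v) = Cell (Vert u) (Vert v)"

abbreviation enc_pairs :: "(nat \<times> nat) list \<Rightarrow> val" where
  "enc_pairs c \<equiv> val_list (map enc_pair c)"

fun enc_result :: "(nat set \<Rightarrow> real) \<Rightarrow> (real \<times> (nat \<times> nat) list) option \<Rightarrow> val" where
  "enc_result w None = Nul"
| "enc_result w (Some r) = Cell (Num (fst r)) (enc_edges w (snd r))"


lemma enc_edge_simps [simp]: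
  "val_fst (enc_edge w e) = Vert (fst e)"
  "val_fst (val_snd (enc_edge w e)) = Vert (snd e)"
  "val_fst (val_snd (val_snd (enc_edge w e))) = Num (w (ends e))"
  by (cases e; simp)+

lemma enc_pair_simps [simp]:
  "val_fst (enc_pair p) = Vert (fst p)" "val_snd (enc_pair p) = Vert (snd p)"
  by (cases p; simp)+

lemma of_truth_eq_Nul [simp]: "of_truth b = Nul \<longleftrightarrow> \<not> b"
  by (simp add: of_truth_def)

lemma of_truth_simps [simp]: "of_truth False = Nul" "of_truth True = Cell Nul Nul"
  by (simp_all add: of_truth_def)

lemma val_list_eq_Nul [simp]: "val_list xs = Nul \<longleftrightarrow> xs = []"
  by (cases xs) simp_all

lemma length_join [simp]: "length (join c e) = Suc (length c)"
  by (simp add: join_def)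

section \<open>Running times of the individual functions\<close>

lemma fn_append:
  "fn prog 21 [val_list xs, val_list ys] (val_list (xs @ ys)) (20 * length xs + 20)"
proof (induction xs)
  case Nil
  show ?case
    by (rule fnI, simp add: length_prog, simp add: prog_nth,
      (rule ev_intros | simp)+)
next
  case (Cons x xs)
  show ?case
    by (rule fnI, simp add: length_prog, simp add: prog_nth,
      (rule ev_intros  Cons.IH | simp)+)
qed

lemma fn_concat:
  "fn prog 2 [val_list (map val_list xss)] (val_list (concat xss)) (20 * length (concat xss) + 50 * length xss + 50)"
proof (induction xss)
  case Nil
  show ?case
    by (rule fnI, simp add: length_prog, simp add: prog_nth,
      (rule ev_intros | simp)+)
next
  case (Cons x xss)
  show ?case
    by (rule fnI, simp add: length_prog, simp add: prog_nth,
      (rule ev_intros fn_append Cons.IH | simp)+)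
qed

lemma fn_insert:
  "fn prog 3 [enc_edge w e, enc_edges w es]
      (enc_edges w (insort_key (\<lambda>e. w (ends e)) e es)) (40 * length es + 40)"
proof (induction es)
  case Nil
  show ?case
    by (rule fnI, simp add: length_prog, simp add: prog_nth,
      (rule ev_intros | simp)+)
next
  case (Cons x es)
  show ?case
  proof (cases "w (ends e) \<le> w (ends x)")
    case True
    show ?thesis
      using True by - (rule fnI, simp add: length_prog, simp add: prog_nth,
        (rule ev_intros  Cons.IH | simp)+)
  next
    case False
    show ?thesis
      using False by - (rule fnI, simp add: length_prog, simp add: prog_nth,
        (rule ev_intros  Cons.IH | simp)+)
  qed
qed

lemma fn_sort:
  "fn prog 4 [enc_edges w es] (enc_edges w (sort_key (\<lambda>e. w (ends e)) es))
      (40 * length es * length es + 100 * length es + 20)"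
proof (induction es)
  case Nil
  show ?case
    by (rule fnI, simp add: length_prog, simp add: prog_nth,
      (rule ev_intros | simp)+)
next
  case (Cons x es)
  show ?case
    by (rule fnI, simp add: length_prog, simp add: prog_nth,
      (rule ev_intros fn_insert Cons.IH | simp)+, simp add: algebra_simps)
qed

text \<open>The target \<open>t\<close> is an arbitrary value and not a vertex because, without
  terminals, the program passes \<open>Nul\<close>, the default of \<open>Fst\<close>.\<close>

lemma fn_star:
  "fn prog 5 [enc_verts ts, t] (val_list (map (\<lambda>v. Cell (Vert v) t) ts)) (20 * length ts + 20)"
proof (induction ts)
  case Nil
  show ?case
    by (rule fnI, simp add: length_prog, simp add: prog_nth,
      (rule ev_intros | simp)+)
next
  case (Cons x ts)
  show ?case
    by (rule fnI, simp add: length_prog, simp add: prog_nth,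
      (rule ev_intros  Cons.IH | simp)+)
qed

lemma fn_subst_eq:
  assumes "v = fst p"
  shows "fn prog 6 [enc_pair p, Vert v] (Vert (snd p)) 20"
  using assms by - (rule fnI, simp add: length_prog, simp add: prog_nth,
    (rule ev_intros | simp)+)

lemma fn_subst_neq:
  assumes "v \<noteq> fst p"
  shows "fn prog 6 [enc_pair p, Vert v] (Vert v) 20"
  using assms by - (rule fnI, simp add: length_prog, simp add: prog_nth,
    (rule ev_intros | simp)+)

lemma fn_label_length:
  "fn prog 7 [enc_pairs c, Vert v] (Vert (label c v)) (40 * length c + 20)"
proof (induction c)
  case Nil
  show ?case
    by (rule fnI, simp add: length_prog, simp add: prog_nth,
      (rule ev_intros | simp)+)
next
  case (Cons x c)
  show ?case
  proof (cases "label c v = fst x")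
    case True
    show ?thesis
      using True by - (rule fnI, simp add: length_prog, simp add: prog_nth,
        (rule ev_intros fn_subst_eq Cons.IH | simp)+)
  next
    case False
    show ?thesis
      using False by - (rule fnI, simp add: length_prog, simp add: prog_nth,
        (rule ev_intros fn_subst_neq Cons.IH | simp)+)
  qed
qed

text \<open>A strict bound \<open>q\<close> on the length is positive and thus also absorbs the
  additive constant.\<close>

lemma fn_label: "length c < q \<Longrightarrow> fn prog 7 [enc_pairs c, Vert v] (Vert (label c v)) (60 * q)"
  by (rule fn_weaken[OF fn_label_length]) simp

lemma fn_loop:
  assumes "length c < q"
  shows "fn prog 8 [enc_pairs c, enc_edge w e] (of_truth (label c (fst e) = label c (snd e))) (140 * q)"
  using assms by - (rule fnI, simp add: length_prog, simp add: prog_nth,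
    (rule ev_intros fn_label[where q = q] | simp)+)

lemma fn_join:
  assumes "length c < q"
  shows "fn prog 9 [enc_pairs c, enc_edge w e] (enc_pairs (join c e)) (140 * q)"
  using assms by - (rule fnI, simp add: length_prog, simp add: prog_nth,
    (rule ev_intros fn_label[where q = q] | simp add: join_def)+)

text \<open>\<open>q\<close> bounds the sum of both lengths because this sum does not grow when an
  edge moves from the list into the labelling; the same \<open>q\<close> then serves throughout the
  induction.\<close>

lemma fn_greedy:
  assumes "length c + length es < q"
  shows "fn prog 10 [enc_pairs c, enc_edges w es] (enc_edges w (greedy c es))
      (400 * q * length es + 10)"
  using assms
proof (induction es arbitrary: c)
  case Nil
  show ?case
    using Nil.prems by - (rule fnI, simp add: length_prog, simp add: prog_nth,
      (rule ev_intros | simp)+)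
next
  case (Cons x es)
  show ?case
  proof (cases "label c (fst x) = label c (snd x)")
    case True
    show ?thesis
      using True Cons.prems by - (rule fnI, simp add: length_prog, simp add: prog_nth,
        (rule ev_intros fn_loop[where q = q] fn_join[where q = q] Cons.IH | simp)+)
  next
    case False
    show ?thesis
      using False Cons.prems by - (rule fnI, simp add: length_prog, simp add: prog_nth,
        (rule ev_intros fn_loop[where q = q] fn_join[where q = q] Cons.IH | simp)+)
  qed
qed

lemma fn_joins:
  assumes "length c + length es < q"
  shows "fn prog 11 [enc_pairs c, enc_edges w es] (enc_pairs (foldl join c es))
      (200 * q * length es + 10)"
  using assms
proof (induction es arbitrary: c)
  case Nil
  show ?case
    using Nil.prems by - (rule fnI, simp add: length_prog, simp add: prog_nth,
      (rule ev_intros | simp)+)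
next
  case (Cons x es)
  show ?case
    using Cons.prems by - (rule fnI, simp add: length_prog, simp add: prog_nth,
      (rule ev_intros fn_join[where q = q] Cons.IH | simp)+)
qed

lemma fn_parallel:
  assumes "length c < q"
  shows "fn prog 12 [enc_pairs c, enc_edge w e, enc_edge w x] (of_truth (parallel c e x)) (300 * q)"
proof (cases "label c (fst e) = label c (fst x)")
  case True
  show ?thesis
    using True assms by - (rule fnI, simp add: length_prog, simp add: prog_nth,
      (rule ev_intros fn_label[where q = q] | simp add: parallel_def)+)
next
  case False
  show ?thesis
    using False assms by - (rule fnI, simp add: length_prog, simp add: prog_nth,
      (rule ev_intros fn_label[where q = q] | simp add: parallel_def)+)
qed

lemma fn_filter_length:
  assumes "length c < q"
  shows "fn prog 13 [enc_pairs c, enc_edge w e, enc_edges w es]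
      (enc_edges w (filter (\<lambda>x. \<not> parallel c e x) es)) (400 * q * length es + 10)"
  using assms
proof (induction es)
  case Nil
  show ?case
    using Nil.prems by - (rule fnI, simp add: length_prog, simp add: prog_nth,
      (rule ev_intros | simp)+)
next
  case (Cons x es)
  show ?case
  proof (cases "parallel c e x")
    case True
    show ?thesis
      using True Cons.prems by - (rule fnI, simp add: length_prog, simp add: prog_nth,
        (rule ev_intros fn_parallel[where q = q] Cons.IH | simp)+)
  next
    case False
    show ?thesis
      using False Cons.prems by - (rule fnI, simp add: length_prog, simp add: prog_nth,
        (rule ev_intros fn_parallel[where q = q] Cons.IH | simp)+)
  qed
qed

text \<open>\<open>r\<close> hides the product \<open>q * q\<close>, so that the arithmetic in
  \<open>fn_dedupe\<close> sees one number instead of a square.\<close>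

lemma fn_filter:
  assumes "length c < q" "length es < q" "q * q \<le> r"
  shows "fn prog 13 [enc_pairs c, enc_edge w e, enc_edges w es]
      (enc_edges w (filter (\<lambda>x. \<not> parallel c e x) es)) (400 * r + 10)"
proof (rule fn_weaken[OF fn_filter_length[OF assms(1)]])
  have "q * length es \<le> q * q" using assms(2) by simp
  then have "q * length es \<le> r" using assms(3) by (rule le_trans)
  then show "400 * q * length es + 10 \<le> 400 * r + 10" by simp
qed

lemma fn_dedupe:
  assumes "length c < q" "length es < q" "q * q \<le> r" "q \<le> r"
  shows "fn prog 14 [enc_pairs c, enc_edges w es] (enc_edges w (dedupe c es)) (700 * r * length es + 10)"
  using assms
proof (induction es)
  case Nil
  show ?case
    using Nil.prems by - (rule fnI, simp add: length_prog, simp add: prog_nth,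
      (rule ev_intros | simp add: le_less_trans[OF length_dedupe])+)
next
  case (Cons x es)
  show ?case
  proof (cases "label c (fst x) = label c (snd x)")
    case True
    show ?thesis
      using True Cons.prems by - (rule fnI, simp add: length_prog, simp add: prog_nth,
        (rule ev_intros fn_loop[where q = q] fn_filter[where q = q and r = r] Cons.IH | simp add: le_less_trans[OF length_dedupe])+)
  next
    case False
    show ?thesis
      using False Cons.prems by - (rule fnI, simp add: length_prog, simp add: prog_nth,
        (rule ev_intros fn_loop[where q = q] fn_filter[where q = q and r = r] Cons.IH | simp add: le_less_trans[OF length_dedupe])+)
  qed
qed

lemma fn_const:
  assumes "length c < q"
  shows "fn prog 15 [enc_pairs c, enc_verts s]
    (of_truth (successively (\<lambda>u v. label c u = label c v) s)) (200 * q * length s + 10)"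
\<comment> \<open>The function stops as soon as the tail is empty, so lists with fewer than two
  entries are the base cases.\<close>
proof (induction s rule: induct_list012)
  case 1
  show ?case
    by (rule fnI, simp add: length_prog, simp add: prog_nth,
      (rule ev_intros | simp)+)
next
  case (2 x)
  show ?case
    by (rule fnI, simp add: length_prog, simp add: prog_nth,
      (rule ev_intros | simp)+)
next
  case (3 x y zs)
  show ?case
  proof (cases "label c x = label c y")
    case True
    show ?thesis
      using True assms by - (rule fnI, simp add: length_prog, simp add: prog_nth,
        (rule ev_intros fn_label[where q = q] "3.IH"(2)[simplified] | simp)+)
  next
    case False
    show ?thesis
      using False assms by - (rule fnI, simp add: length_prog, simp add: prog_nth,
        (rule ev_intros fn_label[where q = q] | simp)+)
  qed
qed

lemma agree_simps [simp]:
  "agree c []"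
  "agree c (s # Ss) \<longleftrightarrow> successively (\<lambda>u v. label c u = label c v) s \<and> agree c Ss"
  by (simp_all add: agree_def)

lemma fn_agree_length:
  assumes "length c < q"
  shows "fn prog 16 [enc_pairs c, enc_sets Ss] (of_truth (agree c Ss))
      (200 * q * length (concat Ss) + 50 * length Ss + 10)"
  using assms
proof (induction Ss)
  case Nil
  show ?case
    using Nil.prems by - (rule fnI, simp add: length_prog, simp add: prog_nth,
      (rule ev_intros | simp add: comp_def)+)
next
  case (Cons x Ss)
  show ?case
  proof (cases "successively (\<lambda>u v. label c u = label c v) x")
    case True
    show ?thesis
      using True Cons.prems by - (rule fnI, simp add: length_prog, simp add: prog_nth,
        (rule ev_intros fn_const[where q = q] Cons.IH | simp add: comp_def)+, simp add: algebra_simps)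
  next
    case False
    show ?thesis
      using False Cons.prems by - (rule fnI, simp add: length_prog, simp add: prog_nth,
        (rule ev_intros fn_const[where q = q] Cons.IH | simp add: comp_def)+, simp add: algebra_simps)
  qed
qed

lemma fn_agree:
  assumes "length c < q" "length (concat Ss) < q" "length Ss < q"
  shows "fn prog 16 [enc_pairs c, enc_sets Ss] (of_truth (agree c Ss)) (200 * (q * q) + 50 * q + 10)"
proof (rule fn_weaken[OF fn_agree_length[OF assms(1)]])
  have "200 * q * length (concat Ss) \<le> 200 * q * q" using assms(2) by (intro mult_le_mono2) simp
  then show "200 * q * length (concat Ss) + 50 * length Ss + 10 \<le> 200 * (q * q) + 50 * q + 10"
    using assms(3) by linarith
qed

lemma enc_result_eq_Nul [simp]: "enc_result w r = Nul \<longleftrightarrow> r = None"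
  by (cases r) simp_all

lemma fn_better: "fn prog 17 [enc_result w r, enc_result w s] (enc_result w (better r s)) 30"
proof (cases r)
  case r: None
  show ?thesis unfolding r
    by (rule fnI, simp add: length_prog, simp add: prog_nth,
      (rule ev_intros | simp)+)
next
  case r: (Some a)
  show ?thesis
  proof (cases s)
    case s: None
    show ?thesis unfolding r s
      by (rule fnI, simp add: length_prog, simp add: prog_nth,
        (rule ev_intros | simp)+)
  next
    case s: (Some b)
    show ?thesis
    proof (cases "fst a \<le> fst b")
      case True
      show ?thesis unfolding r s
        using True by - (rule fnI, simp add: length_prog, simp add: prog_nth,
          (rule ev_intros | simp)+)
    next
      case False
      show ?thesis unfolding r s
        using False by - (rule fnI, simp add: length_prog, simp add: prog_nth,
          (rule ev_intros | simp)+)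
    qed
  qed
qed

lemma fn_extend: "fn prog 18 [enc_edge w e, enc_result w r] (enc_result w (add_edge w e r)) 30"
proof (cases r)
  case r: None
  show ?thesis unfolding r
    by (rule fnI, simp add: length_prog, simp add: prog_nth,
      (rule ev_intros | simp)+)
next
  case r: (Some a)
  show ?thesis unfolding r
    by (rule fnI, simp add: length_prog, simp add: prog_nth,
      (rule ev_intros | simp)+)
qed

text \<open>The two recursive calls, without and with the edge, double the time. The summand
  \<open>500 * q\<close> covers the loop test, the join and the comparison of results; the base
  value covers the test of the terminal sets at a leaf.\<close>

primrec solve_time :: "nat \<Rightarrow> nat \<Rightarrow> nat" where
  "solve_time q 0 = 200 * (q * q) + 100 * q"
| "solve_time q (Suc n) = 2 * solve_time q n + 500 * q"

lemma fn_solve: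
  assumes "length c + length es < q" "length (concat Ss) < q" "length Ss < q"
  shows "fn prog 19 [enc_sets Ss, enc_pairs c, enc_edges w es] (enc_result w (solve w Ss c es))
    (solve_time q (length es))"
  using assms
proof (induction es arbitrary: c)
  case Nil
  show ?case
  proof (cases "agree c Ss")
    case True
    show ?thesis
      using True Nil by - (rule fnI, simp add: length_prog, simp add: prog_nth,
        (rule ev_intros fn_agree[where q = q] | simp)+)
  next
    case False
    show ?thesis
      using False Nil by - (rule fnI, simp add: length_prog, simp add: prog_nth,
        (rule ev_intros fn_agree[where q = q] | simp)+)
  qed
next
  case (Cons x es)
  show ?case
  proof (cases "label c (fst x) = label c (snd x)")
    case True
    show ?thesis
      using True Cons.prems by - (rule fnI, simp add: length_prog, simp add: prog_nth,
        (rule ev_intros fn_loop[where q = q] Cons.IH | simp)+)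
  next
    case False
    show ?thesis
      using False Cons.prems by - (rule fnI, simp add: length_prog, simp add: prog_nth,
        (rule ev_intros fn_loop[where q = q] fn_join[where q = q] fn_better fn_extend Cons.IH | simp)+)
  qed
qed

lemma fn_strip:
  "fn prog 20 [enc_edges w es]
      (val_list (map (\<lambda>e. Cell (Vert (fst e)) (Cell (Vert (snd e)) Nul)) es)) (30 * length es + 10)"
proof (induction es)
  case Nil
  show ?case
    by (rule fnI, simp add: length_prog, simp add: prog_nth,
      (rule ev_intros | simp)+)
next
  case (Cons x es)
  show ?case
    by (rule fnI, simp add: length_prog, simp add: prog_nth,
      (rule ev_intros  Cons.IH | simp)+)
qed

text \<open>The value \<open>[]\<close> for \<open>None\<close> matches \<open>Snd\<close> applied
  to \<open>Nul\<close>, so the time bounds need no assumption that the search succeeds.\<close>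

definition chosen :: "(real \<times> 'b list) option \<Rightarrow> 'b list" where
  "chosen r = (case r of None \<Rightarrow> [] | Some a \<Rightarrow> snd a)"

lemma chosen_simps [simp]: "chosen None = []" "chosen (Some a) = snd a"
  by (simp_all add: chosen_def)

lemma val_snd_enc_result [simp]: "val_snd (enc_result w r) = enc_edges w (chosen r)"
  by (cases r) simp_all

lemma length_chosen_better:
  "length (chosen (better r s)) \<le> max (length (chosen r)) (length (chosen s))"
  by (cases r; cases s) simp_all

lemma length_chosen_add_edge: "length (chosen (add_edge w e r)) \<le> Suc (length (chosen r))"
  by (cases r) simp_all

lemma length_chosen_solve: "length (chosen (solve w Ss c es)) \<le> length es"
proof (induction es arbitrary: c)
  case (Cons e es)
  have "length (chosen (better (solve w Ss c es) (add_edge w e (solve w Ss (join c e) es)))) \<le> Suc (length es)"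
    using Cons.IH[of c] Cons.IH[of "join c e"] length_chosen_add_edge[of w e "solve w Ss (join c e) es"]
      length_chosen_better[of "solve w Ss c es" "add_edge w e (solve w Ss (join c e) es)"]
    by linarith
  then show ?case using Cons.IH[of c] by (simp add: le_SucI)
qed simp

lemma fn_stage3:
  assumes "length c + length es < q" "length (concat Ss) < q" "length Ss < q"
  shows "fn prog 23 [enc_sets Ss, enc_edges w es, enc_pairs c]
    (enc_result w (solve w Ss c (dedupe c es)))
    (solve_time q (length (dedupe c es)) + 700 * (q * q) * length es + 50)"
proof -
  have c: "length c < q" "length es < q" using assms(1) by simp_all
  have "length c + length (dedupe c es) < q"
    using assms(1) length_dedupe[of c es] by simp
  note solve = fn_solve[OF this assms(2,3)]
  have dedupe: "fn prog 14 [enc_pairs c, enc_edges w es] (enc_edges w (dedupe c es))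
      (700 * (q * q) * length es + 10)"
    by (rule fn_dedupe[OF c order.refl le_square])
  show ?thesis
    by (rule fnI, simp add: length_prog, simp add: prog_nth,
      (rule ev_intros dedupe solve | simp)+)
qed

lemma length_foldl_join: "length (foldl join c es) = length c + length es"
  by (induction es arbitrary: c) simp_all

lemma fn_stage2:
  assumes "length b + length es < q" "length (concat Ss) < q" "length Ss < q"
  defines "c \<equiv> foldl join [] b"
  shows "fn prog 22 [enc_sets Ss, enc_edges w es, enc_edges w b]
    (val_list (map (\<lambda>e. Cell (Vert (fst e)) (Cell (Vert (snd e)) Nul))
      (b @ chosen (solve w Ss c (dedupe c es)))))
    (solve_time q (length (dedupe c es)) + 700 * (q * q) * length es + 300 * q * length b + 60 * q + 200)"
proof -
  let ?X = "chosen (solve w Ss c (dedupe c es))"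
  have "length ([] :: (nat \<times> nat) list) + length b < q" using assms(1) by simp
  from fn_joins[OF this] have joins: "fn prog 11 [Nul, enc_edges w b] (enc_pairs c) (200 * q * length b + 10)"
    unfolding c_def by simp
  have "length c + length es < q" using assms(1) by (simp add: c_def length_foldl_join)
  note stage3 = fn_stage3[OF this assms(2,3)]
  have append: "fn prog 21 [enc_edges w b, enc_edges w ?X] (enc_edges w (b @ ?X)) (20 * length b + 20)"
    using fn_append[of "map (enc_edge w) b" "map (enc_edge w) ?X"] by simp
  have len: "length ?X \<le> length es"
    using le_trans[OF length_chosen_solve length_dedupe] .
  define y where "y = val_list (map (\<lambda>e. Cell (Vert (fst e)) (Cell (Vert (snd e)) Nul)) (b @ ?X))"
  have strip: "fn prog 20 [enc_edges w (b @ ?X)] y (30 * q + 10)"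
    unfolding y_def using assms(1) len by (intro fn_weaken[OF fn_strip]) simp
  have "20 * length b \<le> 20 * q" using assms(1) by simp
  then show ?thesis
    unfolding y_def[symmetric]
    by - (rule fnI, simp add: length_prog, simp add: prog_nth,
      (rule ev_intros joins stage3 append strip | simp)+)
qed

text \<open>The edges count twice in \<open>q\<close>: the labelling built from \<open>b\<close> and
  the list still to be processed can each be as long as \<open>es\<close>.\<close>

lemma fn_stage1:
  assumes "2 * length es + length ts < q" "length (concat Ss) < q" "length Ss < q"
  defines "b \<equiv> greedy (map (\<lambda>v. (v, hd ts)) ts) es"
  defines "c \<equiv> foldl join [] b"
  shows "fn prog (Suc 0) [enc_sets Ss, enc_edges w es, enc_verts ts]
    (val_list (map (\<lambda>e. Cell (Vert (fst e)) (Cell (Vert (snd e)) Nul))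
      (b @ chosen (solve w Ss c (dedupe c es)))))
    (solve_time q (length (dedupe c es)) + 700 * (q * q) * length es + 700 * q * length es + 80 * q + 300)"
proof -
  let ?s = "map (\<lambda>v. (v, hd ts)) ts"
  have star: "fn prog 5 [enc_verts ts, val_fst (enc_verts ts)] (enc_pairs ?s) (20 * q + 20)"
  proof -
    have eq: "map (\<lambda>v. Cell (Vert v) (val_fst (enc_verts ts))) ts = map enc_pair ?s"
      by (cases ts) simp_all
    show ?thesis
      by (rule fn_weaken[OF fn_star[of ts "val_fst (enc_verts ts)", unfolded eq]])
        (use assms(1) in simp)
  qed
  have "length ?s + length es < q" using assms(1) by simp
  from fn_greedy[OF this] have greedy: "fn prog 10 [enc_pairs ?s, enc_edges w es] (enc_edges w b)
      (400 * q * length es + 10)"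
    unfolding b_def .
  have len: "length b \<le> length es" unfolding b_def by (rule length_greedy)
  then have "length b + length es < q" using assms(1) by simp
  note stage2 = fn_stage2[OF this assms(2,3), of w, folded c_def]
  have time: "300 * q * length b \<le> 300 * q * length es" using len by (rule mult_le_mono2)
  define y where "y = val_list (map (\<lambda>e. Cell (Vert (fst e)) (Cell (Vert (snd e)) Nul))
      (b @ chosen (solve w Ss c (dedupe c es))))"
  have "fn prog (Suc 0) [enc_sets Ss, enc_edges w es, enc_verts ts] y
    (solve_time q (length (dedupe c es)) + 700 * (q * q) * length es + 300 * q * length b
      + 400 * q * length es + 80 * q + 300)"
    by (rule fnI, simp add: length_prog, simp add: prog_nth,
      (rule ev_intros star greedy stage2[folded y_def] | simp)+)
  then show ?thesis
    unfolding y_def[symmetric] by (rule fn_weaken) (use time in linarith)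
qed

text \<open>This function separates the two halves of the proof: the program is shown to compute it
  in time for arbitrary lists, and its correctness is derived from the validity of the
  instance.\<close>

definition spanning_solution :: "(nat set \<Rightarrow> real) \<Rightarrow> (nat \<times> nat) list \<Rightarrow> nat list list \<Rightarrow> (nat \<times> nat) list" where
  "spanning_solution w es Ss =
    (let es' = sort_key (\<lambda>e. w (ends e)) es; ts = concat Ss;
      b = greedy (map (\<lambda>v. (v, hd ts)) ts) es'; c = foldl join [] b
     in b @ chosen (solve w Ss c (dedupe c es')))"

definition num_candidates :: "(nat set \<Rightarrow> real) \<Rightarrow> (nat \<times> nat) list \<Rightarrow> nat list list \<Rightarrow> nat" where
  "num_candidates w es Ss =
    (let es' = sort_key (\<lambda>e. w (ends e)) es; ts = concat Ss;
      b = greedy (map (\<lambda>v. (v, hd ts)) ts) es'; c = foldl join [] b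
     in length (dedupe c es'))"

text \<open>Adding \<open>500 * q\<close> turns the recurrence into pure doubling, which makes the
  induction immediate.\<close>

lemma solve_time_le: "solve_time q n + 500 * q \<le> 2 ^ n * (200 * (q * q) + 600 * q)"
  by (induction n) (simp_all add: algebra_simps)

lemma fn_main:
  assumes "2 * length es + length (concat Ss) < q" "length Ss < q"
    and x: "x = Cell vs (Cell (enc_edges w es) (Cell (enc_sets Ss) Nul))"
  shows "fn prog 0 [x] (val_list (map (\<lambda>e. Cell (Vert (fst e)) (Cell (Vert (snd e)) Nul)) (spanning_solution w es Ss)))
    (2 ^ num_candidates w es Ss * (4000 * q ^ 3))"
proof -
  define es' where "es' = sort_key (\<lambda>e. w (ends e)) es"
  define y where "y = val_list (map (\<lambda>e. Cell (Vert (fst e)) (Cell (Vert (snd e)) Nul)) (spanning_solution w es Ss))"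
  define n where "n = num_candidates w es Ss"
  have len: "length es' = length es" by (simp add: es'_def)
  have sort: "fn prog 4 [enc_edges w es] (enc_edges w es') (40 * length es * length es + 100 * length es + 20)"
    unfolding es'_def by (rule fn_sort)
  have concat: "fn prog 2 [enc_sets Ss] (enc_verts (concat Ss)) (20 * length (concat Ss) + 50 * length Ss + 50)"
    using fn_concat[of "map (map Vert) Ss"] by (simp add: map_concat[symmetric] comp_def length_concat)
  have "2 * length es' + length (concat Ss) < q" "length (concat Ss) < q" using assms(1) len by simp_all
  note fn_stage1[OF this assms(2), of w]
  then have stage1: "fn prog (Suc 0) [enc_sets Ss, enc_edges w es', enc_verts (concat Ss)] y
      (solve_time q n + 700 * (q * q) * length es + 700 * q * length es + 80 * q + 300)"
    unfolding y_def n_def spanning_solution_def num_candidates_def Let_def es'_def[symmetric] len by simp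
  have "fn prog 0 [x] y
    ((40 * length es * length es + 100 * length es + 20) + (20 * length (concat Ss) + 50 * length Ss + 50)
     + (solve_time q n + 700 * (q * q) * length es + 700 * q * length es + 80 * q + 300) + 40)"
    unfolding x
    by (rule fnI, simp add: length_prog, simp add: prog_nth,
      (rule ev_intros sort concat stage1 | simp)+)
  moreover have "40 * length es * length es + 100 * length es + 20 + (20 * length (concat Ss) + 50 * length Ss + 50)
      + (solve_time q n + 700 * (q * q) * length es + 700 * q * length es + 80 * q + 300) + 40
      \<le> 2 ^ n * (4000 * q ^ 3)"
  proof -
    \<comment> \<open>Polynomial terms are compared with \<open>z\<close> and the search with
      \<open>p\<close>; naming these products leaves linear inequalities. The former contribute 2100
      and the latter 800, which stays below 4000.\<close>
    define z where "z = q * q * q"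
    have m: "length es \<le> q" "length (concat Ss) \<le> q" "length Ss \<le> q" "1 \<le> q" using assms(1,2) by simp_all
    have qq: "q \<le> q * q" by (rule le_square)
    have "q * q * 1 \<le> q * q * q" using m(4) by (rule mult_le_mono2)
    then have qz: "q * q \<le> z" by (simp add: z_def)
    have "length es * length es \<le> q * q" using m(1) m(1) by (rule mult_le_mono)
    moreover have "q * q * length es \<le> z" unfolding z_def using m(1) by (rule mult_le_mono2)
    moreover have "q * length es \<le> q * q" using m(1) by (rule mult_le_mono2)
    ultimately have rest: "40 * (length es * length es) + 100 * length es + 20 + (20 * length (concat Ss) + 50 * length Ss + 50)
      + (700 * (q * q * length es) + 700 * (q * length es) + 80 * q + 300) + 40 \<le> 2100 * z"
      using m qq qz by linarith
    define p where "p = 2 ^ n * z"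
    have "2 ^ n * (200 * (q * q) + 600 * q) \<le> 2 ^ n * (800 * z)" using qq qz by (intro mult_le_mono2) linarith
    with solve_time_le[of q n] have "solve_time q n \<le> 800 * p" unfolding p_def by linarith
    moreover have "1 * z \<le> p" unfolding p_def by (intro mult_le_mono1) simp
    ultimately have "40 * (length es * length es) + 100 * length es + 20 + (20 * length (concat Ss) + 50 * length Ss + 50)
      + (solve_time q n + 700 * (q * q * length es) + 700 * (q * length es) + 80 * q + 300) + 40 \<le> 4000 * p"
      using rest by linarith
    then show ?thesis by (simp add: p_def z_def power3_eq_cube mult.assoc mult.left_commute)
  qed
  ultimately show ?thesis
    unfolding y_def[symmetric] n_def[symmetric] by (rule fn_weaken)
qed


section \<open>Correctness\<close>

lemma sum_list_ends:
  "distinct (map ends es) \<Longrightarrow> sum w (ends ` set es) = (\<Sum>e \<leftarrow> es. w (ends e))" for w :: "'a set \<Rightarrow> real"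
  using sum_list_distinct_conv_sum_set[of "map ends es" w] by (simp add: comp_def)

lemma label_star: "label (map (\<lambda>v. (v, t)) ts) v = (if v \<in> set ts then t else v)"
  by (induction ts) auto

lemma conn_Nil_subset: "conn [] A \<subseteq> conn c A"
  by (rule conn_least) (simp, rule conn_edge)

text \<open>Cut the walk at its first terminal: a step that is not an edge changes the vertex only
  between terminals, so everything before the cut consists of edges. The target \<open>r\<close> has
  to be a terminal, as it would otherwise be merged with them.\<close>

lemma conn_star:
  assumes "(x, t) \<in> conn (map (\<lambda>v. (v, r)) ts) A" "t \<in> set ts" "r \<in> set ts"
  shows "\<exists>u \<in> set ts. (x, u) \<in> conn [] A"
  using assms(1) unfolding conn_def[of "map _ _"]
proof (induction rule: converse_rtrancl_induct)
  case base
  show ?case by (intro bexI[of _ t] conn_refl assms(2))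
next
  case (step x y)
  have "{x, y} \<in> A \<or> label (map (\<lambda>v. (v, r)) ts) x = label (map (\<lambda>v. (v, r)) ts) y"
    using step.hyps(1) by blast
  then have "x = y \<or> x \<in> set ts \<or> {x, y} \<in> A"
    unfolding label_star using assms(3) by metis
  then consider "x = y" | "x \<in> set ts" | "(x, y) \<in> conn [] A" using conn_edge[of x y A "[]"] by blast
  then show ?case
  proof cases
    case 1
    then show ?thesis using step.IH by simp
  next
    case 2
    then show ?thesis by (intro bexI[of _ x] conn_refl)
  next
    case 3
    then show ?thesis using step.IH conn_trans[OF 3] by blast
  qed
qed

lemma forest_empty: "forest {}"
  unfolding forest_def is_cycle_def by (auto intro!: exI[of _ "0::nat"])

locale encoded_instance =
  fixes I :: sf_instance and es :: "(nat \<times> nat) list" and Ss :: "nat list list"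
  assumes valid: "sf_valid I" and es: "lists_edges es (edges I)"
    and Ss: "list_all2 (\<lambda>s S. distinct s \<and> set s = S) Ss (terms I)"
begin

definition "es' = sort_key (\<lambda>e. len I (ends e)) es"
definition "ts = concat Ss"
definition "c0 = map (\<lambda>v. (v, hd ts)) ts"
definition "b = greedy c0 es'"
text \<open>Starts from the empty labelling and not from \<open>c0\<close>: merging terminals is no
  connection, and the second stage still has to pay for linking them.\<close>

definition "c = foldl join [] b"

lemma ends_eq: "(\<lambda>(u, v). {u, v}) = (ends :: nat \<times> nat \<Rightarrow> nat set)"
  by (simp add: fun_eq_iff split_beta)

lemma edges_eq: "ends ` set es' = edges I" and distinct_es': "distinct (map ends es')"
  using es unfolding lists_edges_def ends_eq es'_def by (auto simp: distinct_map)

lemma sorted_es': "sorted (map (\<lambda>e. len I (ends e)) es')"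
  by (simp add: es'_def)

lemma terms_eq: "terms I = map set Ss"
  using Ss by (auto simp: list_all2_conv_all_nth intro!: nth_equalityI)

lemma terminals_eq: "terminals I = set ts"
  by (simp add: terminals_def terms_eq ts_def)

lemma num_terminals_eq: "num_terminals I = length ts"
proof -
  have "\<forall>s \<in> set Ss. distinct s"
    using Ss by (auto simp: list_all2_conv_all_nth in_set_conv_nth)
  then have "map (card \<circ> set) Ss = map length Ss" by (simp add: distinct_card)
  then show ?thesis unfolding num_terminals_def terms_eq ts_def length_concat map_map by (simp only:)
qed

lemma finite_verts: "finite (verts I)"
  and edges_subset: "edges I \<subseteq> {e. e \<subseteq> verts I \<and> card e = 2}"
  and connected_edges: "\<forall>u \<in> verts I. \<forall>v \<in> verts I. linked (edges I) u v"
  and nonneg_edges: "\<forall>e \<in> edges I. 0 \<le> len I e"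
  and terminals_subset: "terminals I \<subseteq> verts I"
  using valid unfolding sf_valid_def by - (elim conjE, assumption)+

lemma nonneg: "e \<in> set es' \<Longrightarrow> 0 \<le> len I (ends e)"
  using nonneg_edges unfolding edges_eq[symmetric] by simp

lemma edge_verts: "{x, y} \<in> edges I \<Longrightarrow> x \<in> verts I \<and> y \<in> verts I"
  using edges_subset by blast

lemma terminals_verts: "set ts \<subseteq> verts I"
  using terminals_subset unfolding terminals_eq .

lemma connected: "x \<in> verts I \<Longrightarrow> y \<in> verts I \<Longrightarrow> (x, y) \<in> conn d (edges I)"
  using connected_edges conn_Nil_subset[of "edges I" d] unfolding linked_iff_conn by blast

lemma conn_b: "conn c0 (ends ` set b) = conn c0 (edges I)"
  unfolding b_def conn_greedy edges_eq ..

lemma label_c: "label c x = label c y \<longleftrightarrow> (x, y) \<in> conn [] (ends ` set b)"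
  unfolding c_def by (rule label_foldl_join)

text \<open>\<open>b\<close> spans the graph with merged terminals, which connects \<open>x\<close>
  to \<open>hd ts\<close> there; \<open>conn_star\<close> extracts a genuine path to some
  terminal.\<close>

lemma reaches_terminal:
  assumes "x \<in> verts I" "ts \<noteq> []"
  shows "\<exists>u \<in> set ts. (x, u) \<in> conn [] (ends ` set b)"
proof -
  have hd: "hd ts \<in> set ts" using assms(2) by simp
  then have "(x, hd ts) \<in> conn c0 (ends ` set b)"
    unfolding conn_b using terminals_verts by (intro connected assms(1)) blast
  then show ?thesis using hd hd unfolding c0_def by (rule conn_star)
qed

text \<open>By \<open>reaches_terminal\<close> every label is that of a terminal. The extra one
  covers the case without terminals: nothing is merged then, \<open>b\<close> spans the whole graph,
  and at most one label remains.\<close>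

lemma card_labels: "finite (label c ` verts I)" "card (label c ` verts I) \<le> Suc (length ts)"
proof -
  show fin: "finite (label c ` verts I)" using finite_verts by simp
  show "card (label c ` verts I) \<le> Suc (length ts)"
  proof (cases "ts = []")
    case True
    then have "c0 = []" by (simp add: c0_def)
    then have "label c x = label c y" if "x \<in> verts I" "y \<in> verts I" for x y
      using connected[OF that, of c0] conn_b unfolding label_c by simp
    then have "card (label c ` verts I) \<le> Suc 0"
      unfolding card_le_Suc0_iff_eq[OF fin] by blast
    then show ?thesis by simp
  next
    case False
    have "label c x \<in> label c ` set ts" if "x \<in> verts I" for x
      using reaches_terminal[OF that False] unfolding label_c[symmetric] by force
    then have "card (label c ` verts I) \<le> card (label c ` set ts)"
      by (intro card_mono) auto
    also have "\<dots> \<le> length ts" using card_image_le[of "set ts" "label c"] card_length[of ts] by simp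
    finally show ?thesis by simp
  qed
qed

lemma length_candidates: "length (dedupe c es') \<le> Suc (length ts) * Suc (length ts)"
proof -
  have "label c (fst e) \<in> label c ` verts I \<and> label c (snd e) \<in> label c ` verts I" if "e \<in> set es'" for e
  proof -
    have "{fst e, snd e} \<in> edges I" using that edges_eq by blast
    then show ?thesis using edge_verts by blast
  qed
  then have "length (dedupe c es') \<le> card (label c ` verts I) * card (label c ` verts I)"
    using card_labels(1) by (rule length_dedupe_le)
  also have "\<dots> \<le> Suc (length ts) * Suc (length ts)" using card_labels(2) by (intro mult_le_mono)
  finally show ?thesis .
qed

lemma OPT_attained:
  assumes "feasible I F"
  obtains F' where "feasible I F'" "total_len I F' = OPT I"
proof -
  have "finite (edges I)" unfolding edges_eq[symmetric] by simp
  then have "finite {F. feasible I F}"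
    by (rule finite_subset[rotated, OF finite_Pow_iff[THEN iffD2]]) (auto simp: feasible_def)
  then have "OPT I \<in> total_len I ` {F. feasible I F}"
    unfolding OPT_def using assms by (intro Min_in) auto
  then show thesis using that by auto
qed

lemma cost_b:
  assumes "feasible I F"
  shows "(\<Sum>e \<leftarrow> b. len I (ends e)) \<le> total_len I F"
  unfolding b_def total_len_def
proof (rule greedy_optimal[OF sorted_es' nonneg])
  show "F \<subseteq> ends ` set es'" using assms unfolding edges_eq feasible_def by blast
  have reach: "\<exists>u \<in> set ts. (x, u) \<in> conn c0 F" if "x \<in> verts I" for x
  proof (cases "x \<in> set ts")
    case True
    then show ?thesis by (intro bexI[of _ x] conn_refl)
  next
    case False
    then have "\<exists>u \<in> set ts. linked F x u" using assms that unfolding feasible_def terminals_eq by blast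
    then show ?thesis unfolding linked_iff_conn using conn_Nil_subset[of F c0] by blast
  qed
  show "conn c0 (ends ` set es') \<subseteq> conn c0 F"
  proof (rule conn_subset)
    fix x y assume "{x, y} \<in> ends ` set es'"
    then have "x \<in> verts I" "y \<in> verts I" using edge_verts unfolding edges_eq by blast+
    then obtain u v where u: "u \<in> set ts" "(x, u) \<in> conn c0 F" and v: "v \<in> set ts" "(y, v) \<in> conn c0 F"
      using reach by blast
    have "label c0 u = label c0 v" using u(1) v(1) by (simp add: c0_def label_star)
    then have "(u, v) \<in> conn c0 F" by (rule conn_label)
    then show "(x, y) \<in> conn c0 F" using u(2) conn_sym[OF v(2)] by (metis conn_trans)
  qed
qed

text \<open>The links of \<open>F\<close> survive the passage to cheapest representatives only
  modulo \<open>c\<close>, which is all that the search asks for.\<close>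

lemma cost_solve:
  assumes "feasible I F"
  obtains r X where "solve (len I) Ss c (dedupe c es') = Some (r, X)" "r \<le> total_len I F"
proof -
  have F: "F \<subseteq> ends ` set es'" using assms unfolding edges_eq feasible_def by blast
  obtain A where A: "A \<subseteq> ends ` set (dedupe c es')" "conn c F \<subseteq> conn c A" "sum (len I) A \<le> sum (len I) F"
    using dedupe_cheapest[OF sorted_es' nonneg distinct_es' F, of c] by blast
  have "\<exists>r. solve (len I) Ss c (dedupe c es') = Some r \<and> fst r \<le> sum (len I) A"
  proof (rule solve_optimal[OF _ A(1)])
    show "0 \<le> len I (ends e)" if "e \<in> set (dedupe c es')" for e
      using nonneg that set_dedupe by blast
    fix s u v assume "s \<in> set Ss" "u \<in> set s" "v \<in> set s"
    then have "linked F u v" using assms unfolding feasible_def terms_eq by auto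
    then show "(u, v) \<in> conn c A" unfolding linked_iff_conn using conn_Nil_subset[of F c] A(2) by blast
  qed
  then show thesis using that A(3) unfolding total_len_def by fastforce
qed

lemma spanning_solution_eq:
  "spanning_solution (len I) es Ss = b @ chosen (solve (len I) Ss c (dedupe c es'))"
  by (simp add: spanning_solution_def Let_def es'_def ts_def c0_def b_def c_def)

lemma num_candidates_eq: "num_candidates (len I) es Ss = length (dedupe c es')"
  by (simp add: num_candidates_def Let_def es'_def ts_def c0_def b_def c_def)

lemma spanning_solution_correct:
  assumes "feasible I F0"
  defines "out \<equiv> spanning_solution (len I) es Ss"
  shows "lists_edges out (ends ` set out)" "feasible I (ends ` set out)"
    "total_len I (ends ` set out) \<le> 2 * OPT I"
proof -
  obtain F where F: "feasible I F" "total_len I F = OPT I" using OPT_attained[OF assms(1)] .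
  obtain r X where X: "solve (len I) Ss c (dedupe c es') = Some (r, X)" "r \<le> total_len I F"
    using cost_solve[OF F(1)] .
  have out: "out = b @ X" unfolding out_def spanning_solution_eq X(1) by simp
  have sound: "indep c X" "set X \<subseteq> set (dedupe c es')" "r = (\<Sum>e \<leftarrow> X. len I (ends e))"
    "agree (foldl join c X) Ss"
    using solve_sound[OF X(1)] by blast+
  have "indep [] b"
    unfolding b_def by (rule indep_coarser[OF indep_greedy[of c0]]) simp
  \<comment> \<open>\<open>X\<close> was selected over the very labelling that \<open>b\<close>
    leaves behind, so the concatenation is independent from scratch.\<close>
  then have indep: "indep [] out" unfolding out indep_append c_def[symmetric] using sound(1) by blast
  have "label [] x = label [] y" if "linked {} x y" for x y :: nat
    using that unfolding linked_iff_conn conn_empty by simp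
  note indep_forest[OF indep forest_empty this]
  then have forest: "forest (ends ` set out)" and dist: "distinct (map ends out)" by simp_all
  show "lists_edges out (ends ` set out)"
    using dist unfolding lists_edges_def ends_eq by simp
  have "total_len I (ends ` set out) = (\<Sum>e \<leftarrow> b. len I (ends e)) + r"
    unfolding total_len_def sum_list_ends[OF dist] sound(3) by (simp add: out)
  then show "total_len I (ends ` set out) \<le> 2 * OPT I"
    using cost_b[OF F(1)] X(2) F(2) by simp
  have sub: "set out \<subseteq> set es'"
    unfolding out b_def using set_greedy[of c0 es'] sound(2) set_dedupe[of c es'] by auto
  have linked: "linked (ends ` set out) u v" if "s \<in> set Ss" "u \<in> set s" "v \<in> set s" for s u v
  proof -
    have "agree (foldl join [] out) Ss" using sound(4) unfolding out c_def foldl_append .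
    then have "label (foldl join [] out) u = label (foldl join [] out) v"
      using that unfolding agree_iff by blast
    then show ?thesis unfolding label_foldl_join linked_iff_conn .
  qed
  have "\<exists>u \<in> set ts. linked (ends ` set out) v u" if v: "v \<in> verts I - set ts" for v
  proof -
    \<comment> \<open>The feasible \<open>F\<close> links \<open>v\<close> to some terminal, so
      there is one.\<close>
    have "ts \<noteq> []" using F(1) v unfolding feasible_def terminals_eq by fastforce
    then obtain u where "u \<in> set ts" "(v, u) \<in> conn [] (ends ` set b)"
      using reaches_terminal v by blast
    moreover have "conn [] (ends ` set b) \<subseteq> conn [] (ends ` set out)"
      unfolding out by (intro conn_mono) auto
    ultimately show ?thesis unfolding linked_iff_conn by blast
  qed
  moreover have "ends ` set out \<subseteq> edges I" using sub edges_eq by blast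
  moreover have "\<forall>S \<in> set (terms I). \<forall>u \<in> S. \<forall>v \<in> S. linked (ends ` set out) u v"
    unfolding terms_eq set_map using linked by blast
  ultimately show "feasible I (ends ` set out)"
    unfolding feasible_def terminals_eq using forest by blast
qed

end


section \<open>The parameter dependence is computable\<close>

lemma unary_simps [simp]: "unary 0 = Nul" "unary (Suc n) = Cell Nul (unary n)"
  by (simp_all add: unary_def)

text \<open>The two extra steps are the evaluation of the argument and the call of position
  0.\<close>

lemma runsI: "fn P 0 [x] y b \<Longrightarrow> \<exists>t \<le> b + 2. runs P x y t"
proof -
  assume "fn P 0 [x] y b"
  moreover have "evs P [x] [Var 0] [x] (1 + 0)" by (intro evs_Cons evs_Nil ev_Var) simp_all
  ultimately have "ev P [x] (Call 0 [Var 0]) y (1 + 0 + b + 1)" by (rule ev_Call[rotated])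
  then show ?thesis unfolding ev_def runs_def by simp
qed

text \<open>The parameter function on unary numbers: entry 1 is the power of two, by repeated
  doubling, and entry 2 is addition.\<close>

definition tower_prog :: program where
  "tower_prog = [
    Call 1 [Call 1 [CellE NulE (CellE NulE (Var 0))]],
    Cond (Var 0) (Call 2 [Call 1 [Snd (Var 0)], Call 1 [Snd (Var 0)]]) (CellE NulE NulE),
    Cond (Var 0) (CellE (Fst (Var 0)) (Call 2 [Snd (Var 0), Var 1])) (Var 1)]"

lemma length_tower_prog: "length tower_prog = 3"
  by (simp add: tower_prog_def)

lemmas tower_prog_nth = arg_cong[OF tower_prog_def, of "\<lambda>P. P ! i" for i]

lemma fn_tower_append: "fn tower_prog 2 [unary m, unary n] (unary (m + n)) (20 * m + 20)"
proof (induction m)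
  case 0
  show ?case
    by (rule fnI, simp add: length_tower_prog, simp add: tower_prog_nth, (rule ev_intros | simp)+)
next
  case (Suc m)
  show ?case
    by (rule fnI, simp add: length_tower_prog, simp add: tower_prog_nth, (rule ev_intros Suc | simp)+)
qed

text \<open>Any finite bound serves, since \<open>computable\<close> asks for termination
  only.\<close>

primrec tower_time :: "nat \<Rightarrow> nat" where
  "tower_time 0 = 10"
| "tower_time (Suc n) = 2 * tower_time n + 20 * 2 ^ n + 50"

lemma fn_tower_double: "fn tower_prog 2 [unary n, unary n] (unary (2 * n)) (20 * n + 20)"
  unfolding mult_2 by (rule fn_tower_append)

lemma fn_tower_exp: "fn tower_prog (Suc 0) [unary n] (unary (2 ^ n)) (tower_time n)"
proof (induction n)
  case 0
  show ?case
    by (rule fnI, simp add: length_tower_prog, simp add: tower_prog_nth, (rule ev_intros | simp)+)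
next
  case (Suc n)
  show ?case
    by (rule fnI, simp add: length_tower_prog, simp add: tower_prog_nth,
      (rule ev_intros Suc fn_tower_double | simp)+)
qed

lemma computable_tower: "computable (\<lambda>n. 2 ^ 2 ^ (n + 2))"
  unfolding computable_def
proof (rule exI[of _ tower_prog], rule allI)
  fix n
  have "fn tower_prog 0 [unary n] (unary (2 ^ 2 ^ Suc (Suc n))) (tower_time (2 ^ Suc (Suc n)) + tower_time (Suc (Suc n)) + 30)"
  proof -
    have exp: "fn tower_prog (Suc 0) [Cell Nul (Cell Nul (unary n))] (unary (2 ^ Suc (Suc n))) (tower_time (Suc (Suc n)))"
      using fn_tower_exp[of "Suc (Suc n)"] by (simp del: tower_time.simps power_Suc)
    note exp2 = fn_tower_exp[of "2 ^ Suc (Suc n)"]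
    show ?thesis
      by (rule fnI, simp add: length_tower_prog,
        simp add: tower_prog_nth del: tower_time.simps power_Suc,
        (rule ev_intros exp exp2 | simp del: tower_time.simps power_Suc)+)
  qed
  then show "\<exists>t. runs tower_prog (unary n) (unary (2 ^ 2 ^ (n + 2))) t"
    unfolding add_2_eq_Suc' using runsI by blast
qed

section \<open>Size of the encoded input and assembly of the bound\<close>

lemma val_size_enc_edges: "val_size (enc_edges w es) = 8 * length es + 1"
  by (induction es) auto

lemma val_size_enc_verts: "val_size (enc_verts s) = 2 * length s + 1"
  by (induction s) auto

lemma val_size_enc_sets: "val_size (enc_sets Ss) = 2 * length (concat Ss) + 2 * length Ss + 1"
  by (induction Ss) (auto simp: val_size_enc_verts)

text \<open>Turns the count of candidates into a power of two, so that the parameter function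
  becomes an iterated power, for which a unary program needs only addition. In the step, the square
  at most doubles once \<open>n\<close> is at least 2; the smaller cases are computed.\<close>

lemma square_le_power2: "Suc n * Suc n \<le> 2 ^ (n + 2)"
proof (induction n)
  case (Suc n)
  show ?case
  proof (cases "n < 2")
    case True
    then have "n = 0 \<or> n = 1" by linarith
    then show ?thesis by (elim disjE) simp_all
  next
    case False
    then have "2 * 2 \<le> n * n" by (intro mult_le_mono) simp_all
    then have "2 * Suc n + 1 \<le> Suc n * Suc n" by simp
    moreover have "Suc (Suc n) * Suc (Suc n) = Suc n * Suc n + (2 * Suc n + 1)" by simp
    ultimately have "Suc (Suc n) * Suc (Suc n) \<le> 2 * (Suc n * Suc n)" by linarith
    also have "\<dots> \<le> 2 * 2 ^ (n + 2)" using Suc.IH by (rule mult_le_mono2)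
    finally show ?thesis by simp
  qed
qed simp

theorem theorem6:
  shows "\<exists>(P :: program) (f :: nat \<Rightarrow> nat) (p :: nat poly). computable f \<and>
    (\<forall>(I :: sf_instance) (x :: val). sf_valid I \<and> encodes_instance x I \<longrightarrow>
      (\<exists>(y :: val) (t :: nat).
        runs P x y t \<and>
        t \<le> f (num_terminals I) * poly p (val_size x) \<and>
        ((\<exists>F. feasible I F) \<longrightarrow>
          (\<exists>F. encodes_edges y F \<and> feasible I F \<and> total_len I F \<le> 2 * OPT I))))"
proof (rule exI[of _ prog], rule exI[of _ "\<lambda>n. 2 ^ 2 ^ (n + 2)"], rule exI[of _ "monom 4002 3"],
    intro conjI allI impI computable_tower, elim conjE)
  fix I x assume valid: "sf_valid I" and "encodes_instance x I"
  then obtain vs es Ss where es: "lists_edges es (edges I)"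
    and Ss: "list_all2 (\<lambda>s S. distinct s \<and> set s = S) Ss (terms I)"
    and x: "x = val_list [val_list (map Vert vs),
        val_list (map (\<lambda>(u, v). val_list [Vert u, Vert v, Num (len I {u, v})]) es),
        val_list (map (\<lambda>s. val_list (map Vert s)) Ss)]"
    unfolding encodes_instance_def by blast
  interpret encoded_instance I es Ss
    using valid es Ss by unfold_locales
  have "(\<lambda>(u, v). val_list [Vert u, Vert v, Num (len I {u, v})]) = enc_edge (len I)"
    by (simp add: fun_eq_iff)
  then have x': "x = Cell (val_list (map Vert vs)) (Cell (enc_edges (len I) es) (Cell (enc_sets Ss) Nul))"
    unfolding x by simp
  define q where "q = val_size x"
  \<comment> \<open>A listed edge takes eight nodes, a terminal two and a terminal set two more, so
    the input size exceeds the lengths that enter the time bound.\<close>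
  have q: "2 * length es + length (concat Ss) < q" "length Ss < q"
    unfolding q_def x' by (simp_all add: val_size_enc_edges val_size_enc_sets)
  define out where "out = spanning_solution (len I) es Ss"
  define y where "y = val_list (map (\<lambda>e. Cell (Vert (fst e)) (Cell (Vert (snd e)) Nul)) out)"
  define n where "n = num_candidates (len I) es Ss"
  have "fn prog 0 [x] y (2 ^ n * (4000 * q ^ 3))"
    unfolding y_def out_def n_def by (rule fn_main[OF q x'])
  then obtain t where t: "t \<le> 2 ^ n * (4000 * q ^ 3) + 2" "runs prog x y t"
    using runsI by blast
  have "n \<le> 2 ^ (num_terminals I + 2)"
    unfolding n_def num_candidates_eq num_terminals_eq
    using length_candidates square_le_power2 by (rule le_trans)
  then have pow: "2 ^ n \<le> (2::nat) ^ 2 ^ (num_terminals I + 2)" by (rule power_increasing) simp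
  \<comment> \<open>The main term is at least one, so the two steps of the entry call are absorbed
    by raising the coefficient 4000 to 4002.\<close>
  have "1 * 1 \<le> 2 ^ n * q ^ 3" using q(2) by (intro mult_le_mono) auto
  moreover have "t \<le> 4000 * (2 ^ n * q ^ 3) + 2" using t(1) by (simp add: mult.left_commute)
  ultimately have "t \<le> 4002 * (2 ^ n * q ^ 3)" by linarith
  then have "t \<le> 2 ^ n * (4002 * q ^ 3)" by (simp add: mult.left_commute)
  also have "\<dots> \<le> 2 ^ 2 ^ (num_terminals I + 2) * (4002 * q ^ 3)" using pow by (rule mult_le_mono1)
  finally have time: "t \<le> 2 ^ 2 ^ (num_terminals I + 2) * poly (monom 4002 3) (val_size x)"
    by (simp add: poly_monom q_def)
  have "(\<lambda>(u, v). val_list [Vert u, Vert v]) = (\<lambda>e. Cell (Vert (fst e)) (Cell (Vert (snd e)) Nul))"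
    by (simp add: fun_eq_iff)
  then have y_eq: "y = val_list (map (\<lambda>(u, v). val_list [Vert u, Vert v]) out)"
    unfolding y_def by simp
  have "encodes_edges y (ends ` set out)" if "feasible I F" for F
    using spanning_solution_correct(1)[OF that]
    unfolding encodes_edges_def y_eq out_def by blast
  then have "\<exists>F. encodes_edges y F \<and> feasible I F \<and> total_len I F \<le> 2 * OPT I" if "feasible I F" for F
    using that spanning_solution_correct(2,3)[OF that] unfolding out_def by blast
  then show "\<exists>y t. runs prog x y t \<and>
      t \<le> 2 ^ 2 ^ (num_terminals I + 2) * poly (monom 4002 3) (val_size x) \<and>
      ((\<exists>F. feasible I F) \<longrightarrow>
        (\<exists>F. encodes_edges y F \<and> feasible I F \<and> total_len I F \<le> 2 * OPT I))"
    using t(2) time by blast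
qed

end
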